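(* Let $V\neq 0$ be a (finite-dimensional) real Euclidean space and let $\mathcal H$ be a finite, central, essential hyperplane arrangement in $V$. The signed groupoid-set $R=C_{\mathcal H}$ is rootoidal if and only if $\mathcal H$ is a simplicial arrangement, i.e. if and only if each chamber of $\mathcal H$ is an open simplicial cone in $V$. In that case, $R$ is complete and principal, and the simple generators (i.e. simple morphisms) of the underlying groupoid are the morphisms between adjacent chambers.
   Context: Arrangements. $\mathcal H$ is central if all its hyperplanes are linear (contain $0$) and essential if the normals to its hyperplanes span $V$. The chambers of $\mathcal H$ are the connected components of $V\setminus\bigcup_{H\in\mathcal H}H$. A hyperplane $H\in\mathcal H$ separates chambers $D,E$ if they lie in different components of $V\setminus H$. Two chambers are adjacent if exactly one $H\in\mathcal H$ separates them. The signed groupoid-set $C_{\mathcal H}=(G,\Phi)$. $G$ is the connected, simply connected groupoid whose objects are the chambers (exactly one morphism $f_{E,D}\colon D\to E$ for each ordered pair of chambers). Let $U$ be the set of all unit normal vectors to hyperplanes in $\mathcal H$, with $\{\pm1\}$ acting by multiplication. For each chamber $D$, $\Phi(D)$ is the set $U$ with specified set of positive elements $\Phi(D)_+=\{u\in U\mid\langle u,v\rangle>0\text{ for all }v\in D\}$, and each morphism $f_{E,D}$ acts as the identity map of $U$ (which is $\{\pm1\}$-equivariant but need not preserve positive elements). Signed groupoid-sets. In general a signed groupoid-set is a pair $(G,\Phi)$ with $G$ a groupoid and $\Phi$ a functor from $G$ to the category of sets $\Theta$ equipped with a free $\{\pm1\}$-action and a specified set $\Theta_+$ of orbit representatives, with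 all equivariant maps as morphisms. Let ${}_aG$ be the set of morphisms with codomain $a$. For $g\colon b\to a$ set $\Phi_g:=\Phi(a)_+\cap\Phi(g)(-\Phi(b)_+)$. The weak order at $a$ is ${}_aL:=\{\Phi_g\mid g\in{}_aG\}$, ordered by inclusion. $(G,\Phi)$ is rootoidal if: (i) $\Phi_g=\emptyset$ with $g\in{}_aG$ implies $g=1_a$; (ii) each ${}_aL$ is a complete meet semilattice (every non-empty subset has a meet); (iii) if $(A_i)_{i\in I}$ is a non-empty family in ${}_aL$ and $B\in{}_aL$ satisfies $A_i\cap B=\emptyset$ for all $i$, and if $A=\bigvee_iA_i$ exists in ${}_aL$, then $A\cap B=\emptyset$. It is complete if each ${}_aL$ is a complete lattice. A morphism $s$ is simple if $|\Phi_s|=1$. $(G,\Phi)$ is principal if every $\Phi_g$ is finite, the set $S$ of simple morphisms generates $G$, and for every morphism $g$ the minimal number of factors in an expression of $g$ as a product of elements of $S$ and their inverses ($0$ for identities) equals $|\Phi_g|$. *)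

theory Defs
  imports "HOL-Analysis.Analysis" "HOL-Algebra.Complete_Lattice"
begin

section \<open>Groupoids and signed groupoid-sets\<close>

text \<open>\<open>Comp G g f\<close> is the product \<open>g f\<close> (first \<open>f\<close>, then \<open>g\<close>); it is meaningful only if
  \<open>Dom G g = Cod G f\<close>.\<close>

record ('o, 'm) groupoid_data =
  Obj :: "'o set"
  Mor :: "'m set"
  Dom :: "'m \<Rightarrow> 'o"
  Cod :: "'m \<Rightarrow> 'o"
  Idt :: "'o \<Rightarrow> 'm"
  Comp :: "'m \<Rightarrow> 'm \<Rightarrow> 'm"

definition inverse_morphisms :: "('o, 'm, 'z) groupoid_data_scheme \<Rightarrow> 'm \<Rightarrow> 'm \<Rightarrow> bool" where
  "inverse_morphisms G g h \<longleftrightarrow>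
     g \<in> Mor G \<and> h \<in> Mor G \<and> Dom G h = Cod G g \<and> Cod G h = Dom G g \<and>
     Comp G h g = Idt G (Dom G g) \<and> Comp G g h = Idt G (Cod G g)"

locale groupoid =
  fixes G :: "('o, 'm, 'z) groupoid_data_scheme"
  assumes Dom_closed: "g \<in> Mor G \<Longrightarrow> Dom G g \<in> Obj G"
    and Cod_closed: "g \<in> Mor G \<Longrightarrow> Cod G g \<in> Obj G"
    and Idt_closed: "a \<in> Obj G \<Longrightarrow> Idt G a \<in> Mor G"
    and Dom_Idt: "a \<in> Obj G \<Longrightarrow> Dom G (Idt G a) = a"
    and Cod_Idt: "a \<in> Obj G \<Longrightarrow> Cod G (Idt G a) = a"
    and Comp_closed:
      "\<lbrakk>g \<in> Mor G; f \<in> Mor G; Dom G g = Cod G f\<rbrakk> \<Longrightarrow> Comp G g f \<in> Mor G"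
    and Dom_Comp:
      "\<lbrakk>g \<in> Mor G; f \<in> Mor G; Dom G g = Cod G f\<rbrakk> \<Longrightarrow> Dom G (Comp G g f) = Dom G f"
    and Cod_Comp:
      "\<lbrakk>g \<in> Mor G; f \<in> Mor G; Dom G g = Cod G f\<rbrakk> \<Longrightarrow> Cod G (Comp G g f) = Cod G g"
    and Comp_assoc:
      "\<lbrakk>h \<in> Mor G; g \<in> Mor G; f \<in> Mor G; Dom G h = Cod G g; Dom G g = Cod G f\<rbrakk>
        \<Longrightarrow> Comp G (Comp G h g) f = Comp G h (Comp G g f)"
    and Comp_Idt_left: "g \<in> Mor G \<Longrightarrow> Comp G (Idt G (Cod G g)) g = g"
    and Comp_Idt_right: "g \<in> Mor G \<Longrightarrow> Comp G g (Idt G (Dom G g)) = g"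
    and ex_inverse: "g \<in> Mor G \<Longrightarrow> \<exists>h. inverse_morphisms G g h"

text \<open>The functor \<open>\<Phi>\<close> is stored as follows: \<open>Roots R a\<close> is the set underlying \<open>\<Phi>(a)\<close>, \<open>Neg R a\<close>
  the action of \<open>-1\<close> on it, \<open>Pos R a\<close> its set \<open>\<Phi>(a)\<^sub>+\<close> of positive elements, and \<open>Act R g\<close> the
  map \<open>\<Phi>(g)\<close>.  An action of \<open>{1, -1}\<close> is the same thing as an involution (the action of \<open>-1\<close>),
  and it is free iff that involution has no fixed point.\<close>

record ('o, 'm, 'r) signed_groupoid_set_data = "('o, 'm) groupoid_data" +
  Roots :: "'o \<Rightarrow> 'r set"
  Neg :: "'o \<Rightarrow> 'r \<Rightarrow> 'r"
  Pos :: "'o \<Rightarrow> 'r set"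
  Act :: "'m \<Rightarrow> 'r \<Rightarrow> 'r"

locale signed_groupoid_set =
  groupoid R for R :: "('o, 'm, 'r) signed_groupoid_set_data" +
  assumes Neg_closed: "\<lbrakk>a \<in> Obj R; x \<in> Roots R a\<rbrakk> \<Longrightarrow> Neg R a x \<in> Roots R a"
    and Neg_Neg: "\<lbrakk>a \<in> Obj R; x \<in> Roots R a\<rbrakk> \<Longrightarrow> Neg R a (Neg R a x) = x"
    and Neg_free: "\<lbrakk>a \<in> Obj R; x \<in> Roots R a\<rbrakk> \<Longrightarrow> Neg R a x \<noteq> x"
    and Pos_subset: "a \<in> Obj R \<Longrightarrow> Pos R a \<subseteq> Roots R a"
    and Pos_orbit_representatives:
      "\<lbrakk>a \<in> Obj R; x \<in> Roots R a\<rbrakk> \<Longrightarrow> \<exists>!y. y \<in> {x, Neg R a x} \<and> y \<in> Pos R a"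
    and Act_closed: "\<lbrakk>g \<in> Mor R; x \<in> Roots R (Dom R g)\<rbrakk> \<Longrightarrow> Act R g x \<in> Roots R (Cod R g)"
    and Act_Neg: "\<lbrakk>g \<in> Mor R; x \<in> Roots R (Dom R g)\<rbrakk>
      \<Longrightarrow> Act R g (Neg R (Dom R g) x) = Neg R (Cod R g) (Act R g x)"
    and Act_Idt: "\<lbrakk>a \<in> Obj R; x \<in> Roots R a\<rbrakk> \<Longrightarrow> Act R (Idt R a) x = x"
    and Act_Comp: "\<lbrakk>g \<in> Mor R; f \<in> Mor R; Dom R g = Cod R f; x \<in> Roots R (Dom R f)\<rbrakk>
      \<Longrightarrow> Act R (Comp R g f) x = Act R g (Act R f x)"

definition inversion_set :: "('o, 'm, 'r) signed_groupoid_set_data \<Rightarrow> 'm \<Rightarrow> 'r set" where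
  "inversion_set R g = Pos R (Cod R g) \<inter> Act R g ` (Neg R (Dom R g) ` Pos R (Dom R g))"

definition weak_order ::
  "('o, 'm, 'r) signed_groupoid_set_data \<Rightarrow> 'o \<Rightarrow> 'r set gorder" where
  "weak_order R a =
     \<lparr>carrier = inversion_set R ` {g \<in> Mor R. Cod R g = a}, eq = (=), le = (\<subseteq>)\<rparr>"

text \<open>Joins and meets are taken inside the poset \<open>weak_order R a\<close>; they need not be unions and
  intersections.\<close>

locale rootoidal = signed_groupoid_set +
  assumes inversion_set_empty:
      "\<lbrakk>g \<in> Mor R; inversion_set R g = {}\<rbrakk> \<Longrightarrow> g = Idt R (Cod R g)"
    and meet_exists:
      "\<lbrakk>a \<in> Obj R; X \<subseteq> carrier (weak_order R a); X \<noteq> {}\<rbrakk>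
        \<Longrightarrow> \<exists>M. greatest (weak_order R a) M (Lower (weak_order R a) X)"
    and join_orthogonality:
      "\<lbrakk>a \<in> Obj R; X \<subseteq> carrier (weak_order R a); X \<noteq> {}; B \<in> carrier (weak_order R a);
        \<And>A. A \<in> X \<Longrightarrow> A \<inter> B = {};
        least (weak_order R a) J (Upper (weak_order R a) X)\<rbrakk>
        \<Longrightarrow> J \<inter> B = {}"

locale complete_signed_groupoid_set = signed_groupoid_set +
  assumes complete_weak_order:
    "a \<in> Obj R \<Longrightarrow> Complete_Lattice.complete_lattice (weak_order R a)"

definition simple_morphisms :: "('o, 'm, 'r) signed_groupoid_set_data \<Rightarrow> 'm set" where
  "simple_morphisms R = {g \<in> Mor R. card (inversion_set R g) = 1}"

text \<open>\<open>is_product G S n g\<close>: \<open>g\<close> is a product of \<open>n\<close> factors, each of them an element of \<open>S\<close> or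
  an inverse of one; the identities are the products of no factors.\<close>

inductive is_product :: "('o, 'm, 'z) groupoid_data_scheme \<Rightarrow> 'm set \<Rightarrow> nat \<Rightarrow> 'm \<Rightarrow> bool"
  for G S where
  identity: "a \<in> Obj G \<Longrightarrow> is_product G S 0 (Idt G a)"
| factor: "\<lbrakk>is_product G S n g; t \<in> Mor G; t \<in> S \<or> (\<exists>s\<in>S. inverse_morphisms G s t);
            Dom G t = Cod G g\<rbrakk> \<Longrightarrow> is_product G S (Suc n) (Comp G t g)"

locale principal_signed_groupoid_set = signed_groupoid_set +
  assumes finite_inversion_set: "g \<in> Mor R \<Longrightarrow> finite (inversion_set R g)"
    and simple_generate: "g \<in> Mor R \<Longrightarrow> \<exists>n. is_product R (simple_morphisms R) n g"
    and length_eq_card: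
      "g \<in> Mor R \<Longrightarrow>
        (LEAST n. is_product R (simple_morphisms R) n g) = card (inversion_set R g)"


section \<open>Hyperplane arrangements\<close>

definition hyperplane_arrangement :: "'a::euclidean_space set set \<Rightarrow> bool" where
  "hyperplane_arrangement \<H> \<longleftrightarrow> (\<forall>H\<in>\<H>. \<exists>u b. u \<noteq> 0 \<and> H = {x. u \<bullet> x = b})"

definition central :: "'a::euclidean_space set set \<Rightarrow> bool" where
  "central \<H> \<longleftrightarrow> (\<forall>H\<in>\<H>. 0 \<in> H)"

definition normals :: "'a::euclidean_space set set \<Rightarrow> 'a set" where
  "normals \<H> = {u. u \<noteq> 0 \<and> (\<exists>H\<in>\<H>. \<exists>b. H = {x. u \<bullet> x = b})}"

definition essential :: "'a::euclidean_space set set \<Rightarrow> bool" where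
  "essential \<H> \<longleftrightarrow> span (normals \<H>) = UNIV"

definition chambers :: "'a::euclidean_space set set \<Rightarrow> 'a set set" where
  "chambers \<H> = components (UNIV - \<Union>\<H>)"

definition separates :: "'a::euclidean_space set \<Rightarrow> 'a set \<Rightarrow> 'a set \<Rightarrow> bool" where
  "separates H D E \<longleftrightarrow>
     (\<exists>P\<in>components (UNIV - H). \<exists>Q\<in>components (UNIV - H). P \<noteq> Q \<and> D \<subseteq> P \<and> E \<subseteq> Q)"

definition adjacent :: "'a::euclidean_space set set \<Rightarrow> 'a set \<Rightarrow> 'a set \<Rightarrow> bool" where
  "adjacent \<H> D E \<longleftrightarrow> D \<in> chambers \<H> \<and> E \<in> chambers \<H> \<and> (\<exists>!H. H \<in> \<H> \<and> separates H D E)"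

definition open_simplicial_cone :: "'a::euclidean_space set \<Rightarrow> bool" where
  "open_simplicial_cone C \<longleftrightarrow>
     (\<exists>B. independent B \<and> span B = UNIV \<and>
          C = {\<Sum>b\<in>B. c b *\<^sub>R b | c. \<forall>b\<in>B. 0 < c b})"

definition simplicial_arrangement :: "'a::euclidean_space set set \<Rightarrow> bool" where
  "simplicial_arrangement \<H> \<longleftrightarrow> (\<forall>D\<in>chambers \<H>. open_simplicial_cone D)"

definition unit_normals :: "'a::euclidean_space set set \<Rightarrow> 'a set" where
  "unit_normals \<H> = {u \<in> normals \<H>. norm u = 1}"


section \<open>The signed groupoid-set of a central arrangement\<close>

text \<open>The pair \<open>(E, D)\<close> encodes the unique morphism \<open>f\<^bsub>E,D\<^esub>\<close> from \<open>D\<close> to \<open>E\<close>.\<close>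

definition arrangement_sgs ::
  "'a::euclidean_space set set \<Rightarrow> ('a set, 'a set \<times> 'a set, 'a) signed_groupoid_set_data" where
  "arrangement_sgs \<H> =
     \<lparr>Obj = chambers \<H>,
      Mor = chambers \<H> \<times> chambers \<H>,
      Dom = snd,
      Cod = fst,
      Idt = (\<lambda>D. (D, D)),
      Comp = (\<lambda>g f. (fst g, snd f)),
      Roots = (\<lambda>D. unit_normals \<H>),
      Neg = (\<lambda>D. uminus),
      Pos = (\<lambda>D. {u \<in> unit_normals \<H>. \<forall>v\<in>D. 0 < u \<bullet> v}),
      Act = (\<lambda>g u. u)\<rparr>"

lemma uminus_unit_normals:
  assumes "u \<in> unit_normals \<H>"
  shows "- u \<in> unit_normals \<H>"
proof -
  from assms obtain H b where "u \<noteq> 0" "norm u = 1" "H \<in> \<H>" "H = {x. u \<bullet> x = b}"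
    by (auto simp: unit_normals_def normals_def)
  then have "- u \<noteq> 0" "norm (- u) = 1" "H = {x. - u \<bullet> x = - b}"
    by auto
  with \<open>H \<in> \<H>\<close> show ?thesis
    unfolding unit_normals_def normals_def by blast
qed

lemma unit_normal_sign_on_chamber:
  assumes "central \<H>" "u \<in> unit_normals \<H>" "D \<in> chambers \<H>"
  shows "(\<forall>v\<in>D. 0 < u \<bullet> v) \<noteq> (\<forall>v\<in>D. 0 < (- u) \<bullet> v)"
proof -
  obtain H b where H: "H \<in> \<H>" "H = {x. u \<bullet> x = b}"
    using assms(2) by (auto simp: unit_normals_def normals_def)
  with assms(1) have "b = 0"
    by (auto simp: central_def)
  have D: "connected D" "D \<noteq> {}" "D \<subseteq> UNIV - \<Union>\<H>"
    using assms(3) in_components_connected in_components_nonempty in_components_subset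
    unfolding chambers_def by blast+
  then have nz: "u \<bullet> v \<noteq> 0" if "v \<in> D" for v
    using that H \<open>b = 0\<close> by blast
  have "\<not> (u \<bullet> v < 0 \<and> 0 < u \<bullet> w)" if "v \<in> D" "w \<in> D" for v w
    using connected_ivt_hyperplane[OF D(1) that, of u 0] nz by fastforce
  then consider "\<forall>v\<in>D. 0 < u \<bullet> v" | "\<forall>v\<in>D. u \<bullet> v < 0"
    using nz by (metis neqE)
  then show ?thesis
    using D(2) by cases (auto dest: less_asym)
qed

lemma signed_groupoid_set_arrangement_sgs:
  fixes \<H> :: "'a::euclidean_space set set"
  assumes "central \<H>"
  shows "signed_groupoid_set (arrangement_sgs \<H>)"
proof (unfold_locales, goal_cases)
  case (12 g)
  then show ?case
    by (auto simp: arrangement_sgs_def inverse_morphisms_def)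
next
  case (15 a x)
  then have "x \<bullet> x \<noteq> 0"
    by (auto simp: arrangement_sgs_def unit_normals_def normals_def)
  moreover have "x \<bullet> x = 0" if "- x = x"
  proof -
    have "x \<bullet> x = - (x \<bullet> x)"
      using that by (metis inner_minus_left)
    then show ?thesis by linarith
  qed
  ultimately have "- x \<noteq> x"
    by blast
  then show ?case
    by (simp add: arrangement_sgs_def)
next
  case (17 a x)
  then show ?case
    using unit_normal_sign_on_chamber[OF assms, of x a] uminus_unit_normals[of x \<H>]
    by (auto simp: arrangement_sgs_def)
qed (auto simp: arrangement_sgs_def uminus_unit_normals)

end

theory Submission
  imports Defs
begin

text \<open>The inversion set of \<open>f\<^bsub>E,D\<^esub>\<close> consists of the positive roots at \<open>E\<close> that are negative on
  \<open>D\<close>, so the weak order at \<open>E\<close> is the poset of regions with base \<open>E\<close>.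
  The inversion set of the chamber \<open>- D\<close> is the complement of that of \<open>D\<close>, which makes the join
  orthogonality axiom automatic; what remains is the theorem of Bjoerner, Edelman and Ziegler that
  all posets of regions are lattices iff the arrangement is simplicial.

  If all joins exist, join orthogonality shows that the simple roots of a chamber admit no linear
  relation, so that the chamber is a simplicial cone. Conversely, in a simplicial arrangement two
  covers of a chamber have as join the opposite chamber across a face of codimension two,
  and in a finite bounded poset such local joins suffice for all meets to exist.\<close>

text \<open>Each hyperplane separating \<open>E\<close> from \<open>D\<close> is represented by its
  unit normal on the side of \<open>E\<close>, so the order theory becomes inclusion, complement and
  cardinality of finite sets of vectors. Geometry enters in two places. The first is the passage
  from the cone generated by the positive roots to the crossing of a single wall. It shows that from
  \<open>E\<close> one can always cross a wall towards another chamber, which drives every induction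
  on the number of separating hyperplanes. The second is the local join. Two walls of a general
  polyhedral cone need not meet in codimension two: opposite sides of the cone over a square meet
  only at the apex. Then the roots that are nonnegative combinations of \<alpha> and \<beta> need
  not be cut off by any chamber, and nothing bounds the chambers beyond both walls from below.
  Simpliciality rules this out, because the walls of a simplicial cone are dual to its spanning
  basis and any two of them meet in a face of codimension two.\<close>

section \<open>Euclidean preliminaries: perturbation, cones, dual bases, half-spaces\<close>

lemma unit_normals_of_same_hyperplane:
  fixes u v :: "'a::euclidean_space"
  assumes "norm u = 1" "norm v = 1" "{x. u \<bullet> x = 0} \<subseteq> {x. v \<bullet> x = 0}"
  shows "v = u \<or> v = - u"
proof -
  have uu: "u \<bullet> u = 1" and vv: "v \<bullet> v = 1"
    using assms by (simp_all add: dot_square_norm)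
  \<comment> \<open>\<open>w\<close> is the component of \<open>v\<close> orthogonal to
    \<open>u\<close>. It lies in the kernel of \<open>u\<close>, hence in that of \<open>v\<close>,
    hence is orthogonal to itself.\<close>
  define w where "w = v - (u \<bullet> v) *\<^sub>R u"
  have uw: "u \<bullet> w = 0"
    by (simp add: w_def inner_diff_right uu)
  then have "v \<bullet> w = 0"
    using assms(3) by blast
  then have "w \<bullet> w = 0"
    using uw by (simp add: w_def inner_diff_left)
  then have v: "v = (u \<bullet> v) *\<^sub>R u"
    by (simp add: w_def)
  then have "\<bar>u \<bullet> v\<bar> = 1"
    using assms(1,2) by (metis mult.right_neutral norm_scaleR)
  then show ?thesis
    using v by (smt (verit) scaleR_minus1_left scaleR_one)
qed

text \<open>For stepping off a face of a chamber: finitely many strict inequalities survive a small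
  enough displacement \<delta>, since each left side tends to 0.\<close>

lemma small_perturbation:
  fixes f g :: "'b \<Rightarrow> real"
  assumes "finite A" "\<And>a. a \<in> A \<Longrightarrow> 0 < f a"
  shows "\<exists>\<delta>>0. \<forall>a\<in>A. \<delta> * g a < f a"
proof -
  have "\<forall>\<^sub>F \<delta> in at_right 0. \<delta> * g a < f a" if "a \<in> A" for a
  proof (rule order_tendstoD(2))
    show "((\<lambda>\<delta>. \<delta> * g a) \<longlongrightarrow> 0) (at_right 0)"
      by (auto intro!: tendsto_eq_intros)
  qed (use assms(2) that in blast)
  then have "\<forall>\<^sub>F \<delta> in at_right (0::real). \<forall>a\<in>A. \<delta> * g a < f a"
    using assms(1) by (simp add: eventually_ball_finite)
  then have "\<forall>\<^sub>F \<delta> in at_right (0::real). 0 < \<delta> \<and> (\<forall>a\<in>A. \<delta> * g a < f a)"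
    using eventually_at_right_less by (rule eventually_conj[rotated])
  then show ?thesis
    using eventually_happens' trivial_limit_at_right_real by blast
qed

text \<open>An open half-space becomes a convex cone once 0 is adjoined. Working with this set
  instead of the closed half-space keeps strict positivity for nonzero elements.\<close>

lemma convex_cone_hull_positive:
  fixes y :: "'a::real_inner"
  assumes "r \<in> convex_cone hull T" "\<And>t. t \<in> T \<Longrightarrow> 0 < t \<bullet> y"
  shows "r = 0 \<or> 0 < r \<bullet> y"
proof -
  have "convex_cone {r. r = 0 \<or> 0 < r \<bullet> y}"
    unfolding convex_cone_iff by (auto simp: inner_add_left zero_less_mult_iff)
  then have "convex_cone hull T \<subseteq> {r. r = 0 \<or> 0 < r \<bullet> y}"
    using assms(2) by (intro hull_minimal) auto
  then show ?thesis using assms(1) by blast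
qed

lemma convex_cone_hull_singleton:
  "convex_cone hull {a} = {c *\<^sub>R a | c. 0 \<le> c}"
proof
  have "convex_cone {c *\<^sub>R a | c. 0 \<le> c}"
    unfolding convex_cone_iff
  proof (intro conjI ballI allI impI)
    show "0 \<in> {c *\<^sub>R a | c. 0 \<le> c}"
      by (rule CollectI, rule exI[of _ 0]) simp
  next
    fix x y assume "x \<in> {c *\<^sub>R a | c. 0 \<le> c}" "y \<in> {c *\<^sub>R a | c. 0 \<le> c}"
    then obtain c d where "x = c *\<^sub>R a" "y = d *\<^sub>R a" "0 \<le> c" "0 \<le> d" by blast
    then have "x + y = (c + d) *\<^sub>R a \<and> 0 \<le> c + d" by (simp add: scaleR_add_left)
    then show "x + y \<in> {c *\<^sub>R a | c. 0 \<le> c}" by blast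
  next
    fix x and d :: real assume "x \<in> {c *\<^sub>R a | c. 0 \<le> c}" "0 \<le> d"
    then obtain c where "x = c *\<^sub>R a" "0 \<le> c" "0 \<le> d" by blast
    then have "d *\<^sub>R x = (d * c) *\<^sub>R a \<and> 0 \<le> d * c" by simp
    then show "d *\<^sub>R x \<in> {c *\<^sub>R a | c. 0 \<le> c}" by blast
  qed
  moreover have "a \<in> {c *\<^sub>R a | c. 0 \<le> c}"
    by (rule CollectI, rule exI[of _ 1]) simp
  ultimately show "convex_cone hull {a} \<subseteq> {c *\<^sub>R a | c. 0 \<le> c}"
    by (intro hull_minimal) simp_all
  show "{c *\<^sub>R a | c. 0 \<le> c} \<subseteq> convex_cone hull {a}"
    using convex_cone_hull_mul[OF hull_inc[of a "{a}"]] by blast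
qed

lemma orthogonal_to_spanning_set:
  fixes v :: "'b::real_inner"
  assumes "span B = UNIV" "\<And>b. b \<in> B \<Longrightarrow> v \<bullet> b = 0"
  shows "v = 0"
proof -
  have "v \<in> span B" using assms(1) by blast
  then have "orthogonal v v"
    by (rule orthogonal_to_span) (use assms(2) in \<open>auto simp: orthogonal_def\<close>)
  then show ?thesis by (simp add: orthogonal_def)
qed

lemma card_Collect_eq_1_iff: "card {x. P x} = 1 \<longleftrightarrow> (\<exists>!x. P x)"
proof
  assume "card {x. P x} = 1"
  then obtain k where "{x. P x} = {k}" by (rule card_1_singletonE)
  then have "P x \<longleftrightarrow> x = k" for x by blast
  then show "\<exists>!x. P x" by simp
next
  assume "\<exists>!x. P x"
  then obtain k where "P k" "\<And>x. P x \<Longrightarrow> x = k" by blast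
  then have "{x. P x} = {k}" by blast
  then show "card {x. P x} = 1" by simp
qed

text \<open>The spanning basis is the dual basis \<open>d\<close> of \<open>S\<close>: the
  coordinate of \<open>x\<close> at \<open>d s\<close> is \<open>s \<bullet> x\<close>, so the
  inequalities say exactly that all coordinates are positive.\<close>

lemma open_simplicial_cone_dual:
  fixes S :: "'a::euclidean_space set"
  assumes indep: "independent S" and span: "span S = UNIV"
  shows "open_simplicial_cone {x. \<forall>s\<in>S. 0 < s \<bullet> x}"
proof -
  have fin: "finite S" using indep by (rule finiteI_independent)
  have "\<exists>b. \<forall>t\<in>S. t \<bullet> b = (if t = s then 1 else 0)" for s
  proof -
    obtain g :: "'a \<Rightarrow> real" where g: "linear g" "\<forall>t\<in>S. g t = (if t = s then 1 else 0)"
      using linear_independent_extend[OF indep, of "\<lambda>t. if t = s then 1 else 0"] by blast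
    \<comment> \<open>\<open>adjoint g 1\<close> is the vector representing the functional
      \<open>g\<close>.\<close>
    have "t \<bullet> adjoint g 1 = g t" for t
      using adjoint_works[OF g(1), of t 1] by simp
    then show ?thesis using g(2) by (intro exI[of _ "adjoint g 1"]) simp
  qed
  then obtain d where d: "\<And>s t. t \<in> S \<Longrightarrow> t \<bullet> d s = (if t = s then 1 else 0)" by metis
  have inj: "inj_on d S"
  proof (rule inj_onI)
    fix s t assume st: "s \<in> S" "t \<in> S" "d s = d t"
    have "s \<bullet> d s = 1" using d[OF st(1), of s] by simp
    then have "(if s = t then 1 else 0) = (1::real)" using d[OF st(1), of t] st(3) by simp
    then show "s = t" by (simp split: if_splits)
  qed
  have coord: "s \<bullet> (\<Sum>b\<in>d ` S. c b *\<^sub>R b) = c (d s)" if "s \<in> S" for c s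
  proof -
    have "s \<bullet> (\<Sum>b\<in>d ` S. c b *\<^sub>R b) = (\<Sum>t\<in>S. c (d t) * (s \<bullet> d t))"
      by (simp add: sum.reindex[OF inj] inner_sum_right)
    also have "\<dots> = (\<Sum>t\<in>S. if s = t then c (d t) else 0)"
      by (rule sum.cong) (simp_all add: d[OF that])
    finally show ?thesis using fin that by simp
  qed
  have expand: "x = (\<Sum>b\<in>d ` S. (the_inv_into S d b \<bullet> x) *\<^sub>R b)" for x
  proof -
    have "(x - (\<Sum>b\<in>d ` S. (the_inv_into S d b \<bullet> x) *\<^sub>R b)) \<bullet> s = 0" if "s \<in> S" for s
      using coord[OF that, of "\<lambda>b. the_inv_into S d b \<bullet> x"] the_inv_into_f_f[OF inj that]
      by (simp add: inner_diff_right inner_commute[of _ s])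
    then have "x - (\<Sum>b\<in>d ` S. (the_inv_into S d b \<bullet> x) *\<^sub>R b) = 0"
      by (rule orthogonal_to_spanning_set[OF span])
    then show ?thesis by simp
  qed
  show ?thesis
    unfolding open_simplicial_cone_def
  proof (intro exI conjI)
    show "independent (d ` S)"
    proof (rule independent_if_scalars_zero)
      show "finite (d ` S)" using fin by simp
      fix f x assume f: "(\<Sum>b\<in>d ` S. f b *\<^sub>R b) = 0" "x \<in> d ` S"
      then obtain s where s: "s \<in> S" "x = d s" by blast
      show "f x = 0" using coord[OF s(1), of f] f(1) s(2) by simp
    qed
    have "x \<in> span (d ` S)" for x
      by (subst expand) (intro span_sum span_scale span_base)
    then show "span (d ` S) = UNIV" by blast
    show "{x. \<forall>s\<in>S. 0 < s \<bullet> x} = {\<Sum>b\<in>d ` S. c b *\<^sub>R b | c. \<forall>b\<in>d ` S. 0 < c b}"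
    proof (intro equalityI subsetI)
      fix x assume "x \<in> {x. \<forall>s\<in>S. 0 < s \<bullet> x}"
      then have "\<forall>b\<in>d ` S. 0 < the_inv_into S d b \<bullet> x"
        by (simp add: the_inv_into_f_f[OF inj])
      with expand[of x] show "x \<in> {\<Sum>b\<in>d ` S. c b *\<^sub>R b | c. \<forall>b\<in>d ` S. 0 < c b}"
        by (intro CollectI exI[of _ "\<lambda>b. the_inv_into S d b \<bullet> x"] conjI)
    next
      fix x assume "x \<in> {\<Sum>b\<in>d ` S. c b *\<^sub>R b | c. \<forall>b\<in>d ` S. 0 < c b}"
      then obtain c where "x = (\<Sum>b\<in>d ` S. c b *\<^sub>R b)" "\<forall>b\<in>d ` S. 0 < c b" by blast
      then show "x \<in> {x. \<forall>s\<in>S. 0 < s \<bullet> x}" by (simp add: coord)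
    qed
  qed
qed

text \<open>A larger connected set avoiding the hyperplane would cross it by the intermediate value
  property. This lets the topological \<open>separates\<close> be read off from signs.\<close>

lemma halfspace_component:
  fixes u :: "'a::euclidean_space"
  assumes "u \<noteq> 0"
  shows "{x. 0 < u \<bullet> x} \<in> components (UNIV - {x. u \<bullet> x = 0})"
  unfolding in_components_maximal
proof (intro conjI allI impI)
  have "u \<in> {x. 0 < u \<bullet> x}" using assms by simp
  then show "{x. 0 < u \<bullet> x} \<noteq> {}" by (rule ex_in_conv[THEN iffD1, OF exI])
  show "connected {x. 0 < u \<bullet> x}" by (intro convex_connected convex_halfspace_gt)
  fix C assume C: "C \<noteq> {} \<and> {x. 0 < u \<bullet> x} \<subseteq> C \<and> C \<subseteq> UNIV - {x. u \<bullet> x = 0} \<and> connected C"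
  have "0 < u \<bullet> x" if "x \<in> C" for x
  proof (rule ccontr)
    assume "\<not> 0 < u \<bullet> x"
    then have "u \<bullet> x \<le> 0" by simp
    moreover have "u \<in> C" using C \<open>u \<in> {x. 0 < u \<bullet> x}\<close> by blast
    ultimately obtain z where "z \<in> C" "u \<bullet> z = 0"
      using connected_ivt_hyperplane[of C x u u 0] C \<open>x \<in> C\<close> inner_ge_zero[of u] by blast
    then show False using C by blast
  qed
  then show "C = {x. 0 < u \<bullet> x}" using C by blast
qed auto

section \<open>Chambers and their sets of positive roots\<close>

locale central_arrangement =
  fixes \<H> :: "'a::euclidean_space set set"
  assumes hyperplanes: "hyperplane_arrangement \<H>"
    and finite_arrangement: "finite \<H>"
    and central: "central \<H>"
    and essential: "essential \<H>"
begin

abbreviation U :: "'a set" where "U \<equiv> unit_normals \<H>"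

definition pos :: "'a set \<Rightarrow> 'a set" where
  "pos D = {u \<in> U. \<forall>v\<in>D. 0 < u \<bullet> v}"

text \<open>The argument order matches the morphism \<open>(E, D)\<close>, whose inversion set this
  is. With \<open>E\<close> fixed, \<open>sep E\<close> embeds the chambers into the weak order at
  \<open>E\<close>, and \<open>card (sep E D)\<close> serves as rank.\<close>

definition sep :: "'a set \<Rightarrow> 'a set \<Rightarrow> 'a set" where
  "sep E D = {u \<in> pos E. - u \<in> pos D}"

lemma norm_unit_normal: "u \<in> U \<Longrightarrow> norm u = 1"
  by (simp add: unit_normals_def)

lemma hyperplane_of_unit_normal:
  assumes "u \<in> U"
  shows "{x. u \<bullet> x = 0} \<in> \<H>"
proof -
  obtain h b where "h \<in> \<H>" "h = {x. u \<bullet> x = b}"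
    using assms unfolding unit_normals_def normals_def by blast
  then show ?thesis
    using central by (auto simp: central_def)
qed

lemma unit_normal_of_hyperplane:
  assumes "h \<in> \<H>"
  obtains u where "u \<in> U" "h = {x. u \<bullet> x = 0}"
proof -
  obtain w b where w: "w \<noteq> 0" "h = {x. w \<bullet> x = b}"
    using assms hyperplanes unfolding hyperplane_arrangement_def by blast
  then have h: "h = {x. w \<bullet> x = 0}"
    using assms central by (auto simp: central_def)
  define u where "u = w /\<^sub>R norm w"
  have "h = {x. u \<bullet> x = 0}"
    using w(1) by (simp add: h u_def)
  moreover have "norm u = 1" "u \<noteq> 0"
    using w(1) by (simp_all add: u_def)
  ultimately show thesis
    using that assms unfolding unit_normals_def normals_def by blast
qed

lemma finite_unit_normals: "finite U"
proof -
  have "finite {u \<in> U. {x. u \<bullet> x = 0} = h}" for h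
  proof (cases "\<exists>v\<in>U. {x. v \<bullet> x = 0} = h")
    case True
    then obtain v where v: "v \<in> U" "{x. v \<bullet> x = 0} = h" by blast
    have "{u \<in> U. {x. u \<bullet> x = 0} = h} \<subseteq> {v, - v}"
      using unit_normals_of_same_hyperplane[of v] norm_unit_normal v by blast
    then show ?thesis
      by (meson finite.emptyI finite.insertI finite_subset)
  next
    case False
    then have "{u \<in> U. {x. u \<bullet> x = 0} = h} = {}" by blast
    then show ?thesis by (metis finite.emptyI)
  qed
  then have "finite (\<Union>h\<in>\<H>. {u \<in> U. {x. u \<bullet> x = 0} = h})"
    using finite_arrangement by blast
  then show ?thesis
    by (rule rev_finite_subset) (use hyperplane_of_unit_normal in blast)
qed

lemma span_unit_normals: "span U = UNIV"
proof -
  have "w \<in> span U" if normal: "w \<in> normals \<H>" for w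
  proof -
    have w: "w \<noteq> 0" using normal by (simp add: normals_def)
    obtain h b where h: "h \<in> \<H>" "h = {x. w \<bullet> x = b}"
      using normal unfolding normals_def by blast
    then have "h = {x. (w /\<^sub>R norm w) \<bullet> x = b / norm w}"
      using w by (auto simp: field_simps)
    then have "w /\<^sub>R norm w \<in> U"
      using h w unfolding unit_normals_def normals_def by auto
    then have "norm w *\<^sub>R (w /\<^sub>R norm w) \<in> span U"
      by (blast intro: span_base span_scale)
    then show ?thesis using w by simp
  qed
  then have "span (normals \<H>) \<subseteq> span U"
    by (simp add: span_minimal subsetI)
  then show ?thesis
    using essential by (auto simp: essential_def)
qed

lemma complement_arrangement: "UNIV - \<Union>\<H> = {x. \<forall>u\<in>U. u \<bullet> x \<noteq> 0}"
proof (intro equalityI subsetI)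
  fix x assume "x \<in> UNIV - \<Union>\<H>"
  then show "x \<in> {x. \<forall>u\<in>U. u \<bullet> x \<noteq> 0}"
    using hyperplane_of_unit_normal by blast
next
  fix x assume x: "x \<in> {x. \<forall>u\<in>U. u \<bullet> x \<noteq> 0}"
  have "x \<notin> h" if "h \<in> \<H>" for h
    using unit_normal_of_hyperplane[OF that] x by blast
  then show "x \<in> UNIV - \<Union>\<H>" by blast
qed

lemma pos_subset: "pos D \<subseteq> U"
  by (auto simp: pos_def)

lemma finite_pos: "finite (pos D)"
  using finite_unit_normals pos_subset finite_subset by blast

lemma chamber_nonempty: "D \<in> chambers \<H> \<Longrightarrow> D \<noteq> {}"
  by (simp add: chambers_def in_components_nonempty)

lemma pos_or_neg:
  assumes "D \<in> chambers \<H>" "u \<in> U"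
  shows "u \<in> pos D \<longleftrightarrow> - u \<notin> pos D"
  using unit_normal_sign_on_chamber[OF central assms(2,1)] assms(2) uminus_unit_normals[OF assms(2)]
  unfolding pos_def by blast

lemma uminus_unit_normal: "- u \<in> U \<longleftrightarrow> u \<in> U"
  using uminus_unit_normals[of u \<H>] uminus_unit_normals[of "- u" \<H>] by auto

lemma pos_at_point:
  assumes "D \<in> chambers \<H>" "x \<in> D"
  shows "pos D = {u \<in> U. 0 < u \<bullet> x}"
proof -
  have "u \<in> pos D" if "u \<in> U" "0 < u \<bullet> x" for u
  proof (rule ccontr)
    assume "u \<notin> pos D"
    then have "- u \<in> pos D" using pos_or_neg assms(1) that(1) by blast
    then have "0 < - u \<bullet> x" using assms(2) unfolding pos_def by blast
    then show False using that(2) by simp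
  qed
  then show ?thesis using assms(2) by (auto simp: pos_def)
qed

text \<open>The region cut out by the signs at \<open>x\<close> is convex, hence connected; conversely no hyperplane
  can be crossed inside a component.\<close>

lemma component_of_generic_point:
  assumes x: "\<forall>u\<in>U. u \<bullet> x \<noteq> 0"
  obtains D where "D \<in> chambers \<H>" "x \<in> D" "{y. \<forall>u\<in>U. 0 < u \<bullet> x \<longrightarrow> 0 < u \<bullet> y} = D"
proof -
  let ?C = "{y. \<forall>u\<in>U. 0 < u \<bullet> x \<longrightarrow> 0 < u \<bullet> y}"
  let ?M = "UNIV - \<Union>\<H>"
  have xM: "x \<in> ?M" using x complement_arrangement by blast
  obtain D where D: "D \<in> components ?M" "x \<in> D"
    using xM by (metis UnionE Union_components)
  then have Dc: "D \<in> chambers \<H>" by (simp add: chambers_def)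
  have eq: "?C = (\<Inter>u\<in>{u\<in>U. 0 < u \<bullet> x}. {y. 0 < u \<bullet> y})" by blast
  have "connected ?C"
    unfolding eq by (intro convex_connected convex_INT convex_halfspace_gt)
  moreover have "?C \<subseteq> ?M"
  proof
    fix y assume y: "y \<in> ?C"
    have "u \<bullet> y \<noteq> 0" if "u \<in> U" for u
    proof (cases "0 < u \<bullet> x")
      case True
      then show ?thesis using y that by force
    next
      case False
      then have "0 < - u \<bullet> x" using x that by (metis inner_minus_left neg_0_less_iff_less linorder_neqE_linordered_idom)
      then have "0 < - u \<bullet> y" using y that uminus_unit_normal by blast
      then show ?thesis by simp
    qed
    then show "y \<in> ?M" by (simp add: complement_arrangement)
  qed
  moreover have "x \<in> ?C" by simp
  ultimately have "?C \<subseteq> D"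
    using D by (intro components_maximal[OF D(1)]) blast+
  moreover have "D \<subseteq> ?C"
    using pos_at_point[OF Dc D(2)] unfolding pos_def by blast
  ultimately show thesis using that Dc D(2) by blast
qed

text \<open>The component through a point of \<open>D\<close> is unique, and it is the region cut
  out by the signs at that point. From here on a chamber is determined by its sign set.\<close>

lemma chamber_eq:
  assumes "D \<in> chambers \<H>"
  shows "D = {y. \<forall>u\<in>pos D. 0 < u \<bullet> y}"
proof -
  obtain x where x: "x \<in> D" using assms chamber_nonempty by blast
  then have "\<forall>u\<in>U. u \<bullet> x \<noteq> 0"
    using assms in_components_subset complement_arrangement unfolding chambers_def by blast
  then obtain E where E: "E \<in> chambers \<H>" "x \<in> E" "{y. \<forall>u\<in>U. 0 < u \<bullet> x \<longrightarrow> 0 < u \<bullet> y} = E"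
    by (rule component_of_generic_point)
  then have "E = D"
    using assms x components_eq unfolding chambers_def by (metis disjoint_iff)
  then show ?thesis using E(3) pos_at_point[OF assms x] by auto
qed

lemma pos_inner: "u \<in> pos D \<Longrightarrow> x \<in> D \<Longrightarrow> 0 < u \<bullet> x"
  by (simp add: pos_def)

lemma mem_chamber_iff: "D \<in> chambers \<H> \<Longrightarrow> y \<in> D \<longleftrightarrow> (\<forall>u\<in>pos D. 0 < u \<bullet> y)"
  by (subst chamber_eq) auto

lemma chamber_eqI: "D \<in> chambers \<H> \<Longrightarrow> E \<in> chambers \<H> \<Longrightarrow> pos D = pos E \<Longrightarrow> D = E"
  using chamber_eq by metis

text \<open>Each sign set contains exactly one of \<open>u\<close> and \<open>- u\<close>, so none
  can be properly contained in another.\<close>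

lemma chamber_eqI_subset:
  assumes "D \<in> chambers \<H>" "E \<in> chambers \<H>" "pos D \<subseteq> pos E"
  shows "D = E"
proof (rule chamber_eqI[OF assms(1,2)])
  show "pos D = pos E"
    using pos_or_neg[OF assms(1)] pos_or_neg[OF assms(2)] pos_subset assms(3) by blast
qed

lemma chamber_of_generic_point:
  assumes "\<And>u. u \<in> U \<Longrightarrow> u \<bullet> x \<noteq> 0"
  obtains D where "D \<in> chambers \<H>" "x \<in> D" "pos D = {u \<in> U. 0 < u \<bullet> x}"
  using assms component_of_generic_point[of x] pos_at_point by metis

section \<open>Simple roots and separation sets\<close>

text \<open>The tool for constructing chambers: a complete choice of signs needs only one point
  realising it. Positivity at \<open>x\<close> prevents \<open>P\<close> from containing both
  \<open>u\<close> and \<open>- u\<close>.\<close>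

lemma chamber_of_signs:
  assumes "P \<subseteq> U" "\<And>u. u \<in> U \<Longrightarrow> u \<in> P \<or> - u \<in> P" "\<And>u. u \<in> P \<Longrightarrow> 0 < u \<bullet> x"
  obtains D where "D \<in> chambers \<H>" "x \<in> D" "pos D = P"
proof -
  have nz: "u \<in> P \<and> 0 < u \<bullet> x \<or> u \<notin> P \<and> u \<bullet> x < 0" if "u \<in> U" for u
    using assms(2)[OF that] assms(3)[of u] assms(3)[of "- u"] by auto
  then have "u \<bullet> x \<noteq> 0" if "u \<in> U" for u
    using that by force
  then obtain D where "D \<in> chambers \<H>" "x \<in> D" "pos D = {u \<in> U. 0 < u \<bullet> x}"
    using chamber_of_generic_point by blast
  moreover have "{u \<in> U. 0 < u \<bullet> x} = P"
    using nz assms(1,3) by fastforce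
  ultimately show thesis using that by blast
qed

lemma opposite_chamber:
  assumes "D \<in> chambers \<H>"
  obtains D' where "D' \<in> chambers \<H>" "pos D' = uminus ` pos D"
proof -
  obtain x where x: "x \<in> D" using assms chamber_nonempty by blast
  show thesis
  proof (rule chamber_of_signs[of "uminus ` pos D" "- x"])
    show "uminus ` pos D \<subseteq> U" using pos_subset uminus_unit_normal by blast
    show "u \<in> uminus ` pos D \<or> - u \<in> uminus ` pos D" if "u \<in> U" for u
      using pos_or_neg[OF assms that] by (metis image_eqI minus_minus)
    show "0 < u \<bullet> - x" if "u \<in> uminus ` pos D" for u
      using that x by (auto simp: pos_def)
  qed (use that in blast)
qed

text \<open>These are the inner normals of the walls of \<open>D\<close>, described combinatorially:
  reversing the sign of \<alpha> alone again gives a chamber.\<close>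

definition simple_roots :: "'a set \<Rightarrow> 'a set" where
  "simple_roots D = {\<alpha> \<in> pos D. \<exists>F\<in>chambers \<H>. pos F = insert (- \<alpha>) (pos D - {\<alpha>})}"

text \<open>The elements of a minimal generating set of the cone are simple: Farkas' lemma gives a point
  \<open>y\<close> on the hyperplane of \<open>\<alpha>\<close> at which all the other positive roots are positive, and the flipped
  chamber lies just behind it.\<close>

lemma pos_subset_cone_simple_roots:
  assumes D: "D \<in> chambers \<H>"
  shows "pos D \<subseteq> convex_cone hull simple_roots D"
proof -
  obtain e where e: "e \<in> D" using D chamber_nonempty by blast
  have e_pos: "0 < u \<bullet> e" if "u \<in> pos D" for u
    using that e by (auto simp: pos_def)
  let ?P = "\<lambda>T. T \<subseteq> pos D \<and> pos D \<subseteq> convex_cone hull T"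
  have "?P (pos D)" by (simp add: hull_subset)
  \<comment> \<open>Least cardinality makes \<open>T\<close> irredundant: no element lies in the
    cone generated by the others.\<close>
  then obtain T where T: "?P T" and T_min: "\<And>T'. ?P T' \<Longrightarrow> card T \<le> card T'"
    using ex_has_least_nat[of ?P "pos D" card] by blast
  have fin_T: "finite T" using T finite_pos finite_subset by blast
  have "\<alpha> \<in> simple_roots D" if \<alpha>: "\<alpha> \<in> T" for \<alpha>
  proof -
    let ?K = "convex_cone hull (T - {\<alpha>})"
    have \<alpha>_pos: "\<alpha> \<in> pos D" using \<alpha> T by blast
    have "\<alpha> \<notin> ?K"
    proof
      assume "\<alpha> \<in> ?K"
      then have "T \<subseteq> ?K" by (auto intro: hull_inc)
      then have "convex_cone hull T \<subseteq> ?K"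
        by (simp add: convex_cone_convex_cone_hull hull_minimal)
      then have "?P (T - {\<alpha>})" using T by blast
      then have "card T \<le> card (T - {\<alpha>})" by (rule T_min)
      then show False using fin_T \<alpha> by (metis card_Diff1_less not_le)
    qed
    moreover have "convex ?K" "closed ?K"
      using fin_T by (simp_all add: convex_convex_cone_hull closed_convex_cone_hull)
    ultimately obtain a b where ab: "a \<bullet> \<alpha> < b" "\<forall>r\<in>?K. b < a \<bullet> r"
      using separating_hyperplane_closed_point by metis
    have "b < a \<bullet> 0"
      using ab(2) convex_cone_hull_contains_0 by blast
    then have b: "b < 0" by simp
    \<comment> \<open>If \<open>a\<close> were negative at \<open>r\<close>, some nonnegative
      multiple of \<open>r\<close> would have value exactly \<open>b\<close>, contradicting strict
      separation.\<close>
    have a_nonneg: "0 \<le> a \<bullet> r" if "r \<in> ?K" for r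
    proof (rule ccontr)
      assume neg: "\<not> 0 \<le> a \<bullet> r"
      then have "(b / (a \<bullet> r)) *\<^sub>R r \<in> ?K"
        using that b by (intro convex_cone_hull_mul) (auto simp: divide_nonpos_neg)
      then have "b < a \<bullet> ((b / (a \<bullet> r)) *\<^sub>R r)" using ab(2) by blast
      then show False using neg by simp
    qed
    \<comment> \<open>This is the unique \<open>s\<close> putting
      \<open>y = a + s *\<^sub>R e\<close> on the hyperplane of \<alpha>. It is positive because
      \<alpha> lies on the negative side of \<open>a\<close>, and adding a positive multiple of
      \<open>e\<close> makes the other generators strictly positive at \<open>y\<close>.\<close>
    define s where "s = - (\<alpha> \<bullet> a) / (\<alpha> \<bullet> e)"
    have s: "0 < s"
      using ab(1) b e_pos[OF \<alpha>_pos] by (simp add: s_def inner_commute field_simps)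
    define y where "y = a + s *\<^sub>R e"
    have \<alpha>y: "\<alpha> \<bullet> y = 0"
      using e_pos[OF \<alpha>_pos] by (simp add: y_def s_def inner_diff_right)
    have t_pos: "0 < t \<bullet> y" if "t \<in> T - {\<alpha>}" for t
    proof -
      have "0 \<le> t \<bullet> a" using a_nonneg[of t] that by (auto simp: inner_commute hull_inc)
      moreover have "0 < s * (t \<bullet> e)" using s e_pos that T by auto
      ultimately show ?thesis by (simp add: y_def inner_add_right)
    qed
    have \<beta>_pos: "0 < \<beta> \<bullet> y" if \<beta>: "\<beta> \<in> pos D - {\<alpha>}" for \<beta>
    proof -
      have "\<beta> \<in> convex_cone hull ({\<alpha>} \<union> (T - {\<alpha>}))"
        using \<beta> T \<alpha> by (simp add: insert_absorb subset_iff)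
      then obtain c r where cr: "0 \<le> c" "r \<in> ?K" "\<beta> = c *\<^sub>R \<alpha> + r"
        unfolding convex_cone_hull_Un convex_cone_hull_singleton by blast
      \<comment> \<open>Otherwise \<beta> is a nonnegative multiple of \<alpha>, and two such unit
        vectors coincide.\<close>
      have "r \<noteq> 0"
      proof
        assume "r = 0"
        moreover have "norm \<beta> = 1" "norm \<alpha> = 1"
          using \<beta> \<alpha>_pos pos_subset norm_unit_normal by blast+
        ultimately show False using cr(1,3) \<beta> by simp
      qed
      then have "0 < r \<bullet> y" using convex_cone_hull_positive[OF cr(2) t_pos] by blast
      then show ?thesis by (simp add: cr(3) inner_add_left \<alpha>y)
    qed
    have "\<exists>\<delta>>0. \<forall>\<beta>\<in>pos D - {\<alpha>}. \<delta> * (\<beta> \<bullet> e) < \<beta> \<bullet> y"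
      using \<beta>_pos finite_pos by (intro small_perturbation) auto
    then obtain \<delta> where \<delta>: "0 < \<delta>" "\<And>\<beta>. \<beta> \<in> pos D - {\<alpha>} \<Longrightarrow> \<delta> * (\<beta> \<bullet> e) < \<beta> \<bullet> y"
      by blast
    show ?thesis
    proof (rule chamber_of_signs[of "insert (- \<alpha>) (pos D - {\<alpha>})" "y - \<delta> *\<^sub>R e"])
      show "insert (- \<alpha>) (pos D - {\<alpha>}) \<subseteq> U"
        using \<alpha>_pos pos_subset uminus_unit_normal by blast
      show "u \<in> insert (- \<alpha>) (pos D - {\<alpha>}) \<or> - u \<in> insert (- \<alpha>) (pos D - {\<alpha>})" if "u \<in> U" for u
        using pos_or_neg[OF D that] by auto
      show "0 < u \<bullet> (y - \<delta> *\<^sub>R e)" if "u \<in> insert (- \<alpha>) (pos D - {\<alpha>})" for u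
      proof (cases "u = - \<alpha>")
        case True
        then show ?thesis using \<alpha>y \<delta>(1) e_pos[OF \<alpha>_pos] by (simp add: inner_diff_right)
      next
        case False
        then show ?thesis using \<delta>(2)[of u] that by (simp add: inner_diff_right)
      qed
    qed (use \<alpha>_pos in \<open>auto simp: simple_roots_def\<close>)
  qed
  then have "convex_cone hull T \<subseteq> convex_cone hull simple_roots D"
    by (intro hull_mono) blast
  then show ?thesis using T by blast
qed

lemma pos_nonzero: "u \<in> pos D \<Longrightarrow> u \<noteq> 0"
  using pos_subset norm_unit_normal by fastforce

lemma simple_roots_subset: "simple_roots D \<subseteq> pos D"
  by (auto simp: simple_roots_def)

lemma pos_positive_of_simple_roots:
  assumes "D \<in> chambers \<H>" "\<And>\<alpha>. \<alpha> \<in> simple_roots D \<Longrightarrow> 0 < \<alpha> \<bullet> x" "u \<in> pos D"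
  shows "0 < u \<bullet> x"
  using convex_cone_hull_positive[of u "simple_roots D" x] assms pos_subset_cone_simple_roots
    pos_nonzero by blast

lemma uminus_pos_iff:
  assumes "D \<in> chambers \<H>" "u \<in> U"
  shows "- u \<in> pos D \<longleftrightarrow> u \<notin> pos D"
  using pos_or_neg[OF assms] by blast

lemma sep_self: "D \<in> chambers \<H> \<Longrightarrow> sep D D = {}"
  using pos_or_neg pos_subset by (auto simp: sep_def)

lemma sep_eq_diff:
  assumes "D \<in> chambers \<H>"
  shows "sep E D = pos E - pos D"
  using uminus_pos_iff[OF assms] pos_subset by (auto simp: sep_def)

lemma sep_swap: "sep D E = uminus ` sep E D"
proof -
  have "u \<in> uminus ` sep E D \<longleftrightarrow> - u \<in> sep E D" for u
    by (metis image_eqI image_iff minus_minus)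
  then show ?thesis by (auto simp: sep_def)
qed

lemma card_sep_swap: "card (sep D E) = card (sep E D)"
  by (simp add: sep_swap[of D E] card_image)

lemma finite_sep: "finite (sep E D)"
  using finite_pos by (simp add: sep_def)

text \<open>If every simple root of \<open>E\<close> were positive at a point of \<open>D\<close>,
  so would be the cone they generate, hence all of \<open>pos E\<close>, forcing
  \<open>E = D\<close>.\<close>

lemma simple_root_separating:
  assumes "E \<in> chambers \<H>" "D \<in> chambers \<H>" "E \<noteq> D"
  obtains \<alpha> where "\<alpha> \<in> simple_roots E" "\<alpha> \<in> sep E D"
proof -
  obtain x where x: "x \<in> D" using assms(2) chamber_nonempty by blast
  have "\<exists>\<alpha>\<in>simple_roots E. \<not> 0 < \<alpha> \<bullet> x"
  proof (rule ccontr)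
    assume "\<not> ?thesis"
    then have "pos E \<subseteq> pos D"
      using pos_positive_of_simple_roots[OF assms(1)] pos_at_point[OF assms(2) x] pos_subset
      by blast
    then show False using chamber_eqI_subset assms by blast
  qed
  then show thesis
    using that pos_at_point[OF assms(2) x] simple_roots_subset
    by (auto simp: sep_eq_diff[OF assms(2)])
qed

lemma flip:
  assumes "E \<in> chambers \<H>" "\<alpha> \<in> simple_roots E"
  obtains F where "F \<in> chambers \<H>" "pos F = insert (- \<alpha>) (pos E - {\<alpha>})" "sep E F = {\<alpha>}"
proof -
  obtain F where F: "F \<in> chambers \<H>" "pos F = insert (- \<alpha>) (pos E - {\<alpha>})"
    using assms(2) by (auto simp: simple_roots_def)
  have \<alpha>: "\<alpha> \<in> pos E" "\<alpha> \<in> U" using assms(2) simple_roots_subset pos_subset by blast+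
  have "- \<alpha> \<notin> pos E" using \<alpha> uminus_pos_iff[OF assms(1)] by blast
  then have "sep E F = {\<alpha>}"
    using \<alpha>(1) by (auto simp: sep_eq_diff[OF F(1)] F(2))
  then show thesis using that F by blast
qed

lemma sep_flip:
  assumes "D \<in> chambers \<H>" "\<alpha> \<in> sep E D" "pos F = insert (- \<alpha>) (pos E - {\<alpha>})"
  shows "sep F D = sep E D - {\<alpha>}"
proof -
  have "- \<alpha> \<in> pos D" using assms(2) by (simp add: sep_def)
  then show ?thesis using assms(3) by (auto simp: sep_eq_diff[OF assms(1)])
qed

section \<open>Joins and meets in simplicial arrangements\<close>

context
  fixes D B
  assumes D: "D \<in> chambers \<H>" and indep: "independent B" and span: "span B = UNIV"
    and cone: "D = {\<Sum>b\<in>B. c b *\<^sub>R b | c. \<forall>b\<in>B. 0 < c b}"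
begin

lemma finite_basis: "finite B"
  using indep by (rule finiteI_independent)

lemma coneI: "y = (\<Sum>b\<in>B. c b *\<^sub>R b) \<Longrightarrow> (\<And>b. b \<in> B \<Longrightarrow> 0 < c b) \<Longrightarrow> y \<in> D"
  unfolding cone by blast

lemma sum_basis_mem: "\<Sum>B \<in> D"
  by (rule coneI[of _ "\<lambda>_. 1"]) simp_all

text \<open>A root negative at \<open>b\<close> would vanish somewhere on the ray from
  \<open>\<Sum>B\<close> in direction \<open>b\<close>, which stays inside \<open>D\<close>;
  \<open>t\<close> marks that point.\<close>

lemma pos_nonneg_on_basis:
  assumes u: "u \<in> pos D" and b: "b \<in> B"
  shows "0 \<le> u \<bullet> b"
proof (rule ccontr)
  assume neg: "\<not> 0 \<le> u \<bullet> b"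
  have s: "0 < u \<bullet> \<Sum>B" using u sum_basis_mem by (auto simp: pos_def)
  define t where "t = - (u \<bullet> \<Sum>B) / (u \<bullet> b)"
  have t: "0 < t" using neg s by (simp add: t_def field_simps)
  have "\<Sum>B + t *\<^sub>R b = (\<Sum>b'\<in>B. (1 + (if b' = b then t else 0)) *\<^sub>R b')"
    using finite_basis b by (simp add: scaleR_add_left sum.distrib if_distrib[of "\<lambda>c. c *\<^sub>R _"] cong: if_cong)
  then have "\<Sum>B + t *\<^sub>R b \<in> D" by (rule coneI) (use t in auto)
  then have "0 < u \<bullet> (\<Sum>B + t *\<^sub>R b)" using u by (auto simp: pos_def)
  moreover have "u \<bullet> (\<Sum>B + t *\<^sub>R b) = 0" using neg by (simp add: t_def inner_diff_right)
  ultimately show False by simp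
qed

text \<open>The sum of the other basis vectors is not in \<open>D\<close>, so some positive root is
  nonpositive there. Being nonnegative on each summand, it vanishes on all of them.\<close>

lemma wall_opposite_basis_vector:
  assumes b: "b \<in> B"
  obtains u where "u \<in> pos D" "0 < u \<bullet> b" "\<And>b'. b' \<in> B - {b} \<Longrightarrow> u \<bullet> b' = 0"
proof -
  let ?q = "\<Sum>(B - {b})"
  have "?q \<notin> D"
  proof
    assume "?q \<in> D"
    then obtain c where c: "?q = (\<Sum>b\<in>B. c b *\<^sub>R b)" "\<forall>b\<in>B. 0 < c b"
      unfolding cone by blast
    have "?q = (\<Sum>b'\<in>B. (if b' = b then 0 else 1) *\<^sub>R b')"
      using finite_basis b by (simp add: sum.remove)
    then have "(\<Sum>b'\<in>B. (c b' - (if b' = b then 0 else 1)) *\<^sub>R b') = 0"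
      using c(1) by (simp add: scaleR_diff_left sum_subtractf)
    then have "c b - (if b = b then 0 else 1) = 0"
      by (rule independentD[OF indep finite_basis subset_refl _ b,
            where u = "\<lambda>b'. c b' - (if b' = b then 0 else 1)"])
    then show False using c(2) b by force
  qed
  then obtain u where u: "u \<in> pos D" "u \<bullet> ?q \<le> 0"
    unfolding mem_chamber_iff[OF D] by force
  have nonneg: "\<And>b'. b' \<in> B - {b} \<Longrightarrow> 0 \<le> u \<bullet> b'"
    using pos_nonneg_on_basis u(1) by blast
  have "(\<Sum>b'\<in>B - {b}. u \<bullet> b') = 0"
  proof (rule antisym)
    show "(\<Sum>b'\<in>B - {b}. u \<bullet> b') \<le> 0" using u(2) by (simp add: inner_sum_right)
  qed (rule sum_nonneg[OF nonneg])
  then have z: "\<And>b'. b' \<in> B - {b} \<Longrightarrow> u \<bullet> b' = 0"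
    using sum_nonneg_eq_0_iff[of "B - {b}" "\<lambda>b'. u \<bullet> b'"] nonneg finite_basis by blast
  have "0 < u \<bullet> \<Sum>B" using u(1) sum_basis_mem by (auto simp: pos_def)
  moreover have "u \<bullet> \<Sum>B = (\<Sum>b'\<in>B. u \<bullet> b')" by (simp add: inner_sum_right)
  moreover have "\<dots> = u \<bullet> b" using z finite_basis b by (simp add: sum.remove)
  ultimately show thesis using that u(1) z by simp
qed

text \<open>A point of the flipped chamber has some nonpositive coordinate. The root of the wall
  opposite that basis vector is then not positive on the flipped chamber, and \<alpha> is the only
  root of \<open>D\<close> that changed sign.\<close>

lemma simple_root_dual_to_basis:
  assumes \<alpha>: "\<alpha> \<in> simple_roots D"
  obtains b where "b \<in> B" "0 < \<alpha> \<bullet> b" "\<And>b'. b' \<in> B - {b} \<Longrightarrow> \<alpha> \<bullet> b' = 0"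
proof -
  obtain F where F: "F \<in> chambers \<H>" "pos F = insert (- \<alpha>) (pos D - {\<alpha>})" "sep D F = {\<alpha>}"
    by (rule flip[OF D \<alpha>])
  obtain y where y: "y \<in> F" using F(1) chamber_nonempty by blast
  obtain c where c: "y = (\<Sum>b\<in>B. c b *\<^sub>R b)"
    using span span_finite[OF finite_basis] by blast
  have "y \<notin> D"
  proof
    assume "y \<in> D"
    then have "pos D = pos F" using pos_at_point D F(1) y by simp
    then show False using F(3) by (simp add: sep_eq_diff F(1))
  qed
  then obtain b where b: "b \<in> B" "c b \<le> 0"
    using coneI[OF c] by force
  obtain u where u: "u \<in> pos D" "0 < u \<bullet> b" "\<And>b'. b' \<in> B - {b} \<Longrightarrow> u \<bullet> b' = 0"
    using wall_opposite_basis_vector[OF b(1)] by blast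
  have "u \<bullet> y = (\<Sum>b'\<in>B. c b' * (u \<bullet> b'))" by (simp add: c inner_sum_right)
  also have "\<dots> = c b * (u \<bullet> b)" using u(3) finite_basis b(1) by (simp add: sum.remove)
  finally have "u \<bullet> y = c b * (u \<bullet> b)" .
  then have "u \<bullet> y \<le> 0" using b(2) u(2) by (simp add: mult_nonpos_nonneg)
  then have "u \<notin> pos F" using y pos_inner[of u F y] by auto
  then have "u = \<alpha>" using u(1) F(2) by blast
  then show thesis using that b(1) u by blast
qed

end

text \<open>\<open>W\<close> is the chamber opposite to \<open>D\<close> across the codimension two face on which \<open>\<alpha>\<close> and
  \<open>\<beta>\<close> vanish; simpliciality guarantees that this face exists.\<close>

lemma opposite_across_codim_two_face:
  assumes D: "D \<in> chambers \<H>" and simplicial: "open_simplicial_cone D"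
    and \<alpha>: "\<alpha> \<in> simple_roots D" and \<beta>: "\<beta> \<in> simple_roots D" and "\<alpha> \<noteq> \<beta>"
  obtains W where "W \<in> chambers \<H>" "\<alpha> \<in> sep D W" "\<beta> \<in> sep D W"
    "\<And>u. u \<in> sep D W \<Longrightarrow> \<exists>c d. 0 \<le> c \<and> 0 \<le> d \<and> u = c *\<^sub>R \<alpha> + d *\<^sub>R \<beta>"
proof -
  obtain B where B: "independent B" "span B = UNIV"
    "D = {\<Sum>b\<in>B. c b *\<^sub>R b | c. \<forall>b\<in>B. 0 < c b}"
    using simplicial unfolding open_simplicial_cone_def by blast
  note basis = D B
  have fin: "finite B" by (rule finite_basis[OF basis])
  obtain a where a: "a \<in> B" "0 < \<alpha> \<bullet> a" "\<And>b'. b' \<in> B - {a} \<Longrightarrow> \<alpha> \<bullet> b' = 0"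
    by (rule simple_root_dual_to_basis[OF basis \<alpha>]) blast
  obtain b where b: "b \<in> B" "0 < \<beta> \<bullet> b" "\<And>b'. b' \<in> B - {b} \<Longrightarrow> \<beta> \<bullet> b' = 0"
    by (rule simple_root_dual_to_basis[OF basis \<beta>]) blast
  have \<alpha>\<beta>: "\<alpha> \<in> pos D" "\<beta> \<in> pos D" using \<alpha> \<beta> simple_roots_subset by blast+
  have "a \<noteq> b"
  proof
    assume "a = b"
    \<comment> \<open>Roots dual to the same basis vector are proportional; \<open>k\<close> is the
      ratio, and unit length forces it to be 1.\<close>
    define k where "k = (\<alpha> \<bullet> a) / (\<beta> \<bullet> a)"
    have k: "0 < k" using a b \<open>a = b\<close> by (simp add: k_def)
    have "(\<alpha> - k *\<^sub>R \<beta>) \<bullet> b' = 0" if "b' \<in> B" for b'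
      using a b \<open>a = b\<close> that by (cases "b' = a") (auto simp: k_def inner_diff_left)
    then have "\<alpha> - k *\<^sub>R \<beta> = 0" by (rule orthogonal_to_spanning_set[OF B(2)])
    then have \<alpha>_eq: "\<alpha> = k *\<^sub>R \<beta>" by simp
    moreover have "norm \<alpha> = 1" "norm \<beta> = 1"
      using \<alpha>\<beta> pos_subset norm_unit_normal by blast+
    ultimately have "k = 1" using k by (metis abs_of_pos mult.right_neutral norm_scaleR)
    then show False using \<alpha>_eq \<open>\<alpha> \<noteq> \<beta>\<close> by simp
  qed
  \<comment> \<open>A point in the relative interior of the face spanned by all basis vectors but
    \<open>a\<close> and \<open>b\<close>. If there are no others it is 0, and \<open>W\<close>
    becomes the chamber opposite to \<open>D\<close>.\<close>
  let ?p = "\<Sum>(B - {a, b})"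
  have p: "u \<bullet> ?p = (\<Sum>b'\<in>B - {a, b}. u \<bullet> b')" for u by (simp add: inner_sum_right)
  have nonneg: "0 \<le> u \<bullet> b'" if "u \<in> pos D" "b' \<in> B" for u b'
    using pos_nonneg_on_basis[OF basis] that by blast
  have p_nonneg: "0 \<le> u \<bullet> ?p" if "u \<in> pos D" for u
    unfolding p using nonneg that by (intro sum_nonneg) blast
  have \<alpha>\<beta>p: "\<alpha> \<bullet> ?p = 0" "\<beta> \<bullet> ?p = 0"
    unfolding p using a(3) b(3) by (intro sum.neutral; blast)+
  obtain e where e: "e \<in> D" using D chamber_nonempty by blast
  have "\<exists>\<delta>>0. \<forall>u\<in>{u \<in> pos D. 0 < u \<bullet> ?p}. \<delta> * (u \<bullet> e) < u \<bullet> ?p"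
    using finite_pos by (intro small_perturbation) simp_all
  then obtain \<delta> where \<delta>: "0 < \<delta>" "\<And>u. u \<in> {u \<in> pos D. 0 < u \<bullet> ?p} \<Longrightarrow> \<delta> * (u \<bullet> e) < u \<bullet> ?p"
    by blast
  \<comment> \<open>Passing through \<open>?p\<close> away from \<open>e\<close> reverses exactly
    the roots that vanish at \<open>?p\<close>.\<close>
  let ?P = "{u \<in> pos D. 0 < u \<bullet> ?p} \<union> uminus ` {u \<in> pos D. u \<bullet> ?p = 0}"
  obtain W where W: "W \<in> chambers \<H>" "pos W = ?P"
  proof (rule chamber_of_signs[of ?P "?p - \<delta> *\<^sub>R e"])
    show "?P \<subseteq> U" using pos_subset uminus_unit_normal by blast
    show "u \<in> ?P \<or> - u \<in> ?P" if u: "u \<in> U" for u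
    proof -
      have *: "v \<in> ?P \<or> - v \<in> ?P" if "v \<in> pos D" for v
        using p_nonneg[OF that] that by fastforce
      consider "u \<in> pos D" | "- u \<in> pos D" using pos_or_neg[OF D u] by blast
      then show ?thesis
      proof cases
        case 1
        then show ?thesis by (rule *)
      next
        case 2
        then have "- u \<in> ?P \<or> - (- u) \<in> ?P" by (rule *)
        then show ?thesis by (simp only: minus_minus disj_commute)
      qed
    qed
    show "0 < u \<bullet> (?p - \<delta> *\<^sub>R e)" if "u \<in> ?P" for u
      using that
    proof
      assume "u \<in> {u \<in> pos D. 0 < u \<bullet> ?p}"
      then show ?thesis using \<delta>(2) by (simp add: inner_diff_right)
    next
      assume "u \<in> uminus ` {u \<in> pos D. u \<bullet> ?p = 0}"
      then obtain v where v: "v \<in> pos D" "v \<bullet> ?p = 0" "u = - v" by blast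
      have "0 < v \<bullet> e" using v(1) e by (auto simp: pos_def)
      then show ?thesis using v \<delta>(1) by (simp add: inner_diff_right)
    qed
  qed
  have sepW: "sep D W = {u \<in> pos D. u \<bullet> ?p = 0}"
  proof -
    have "u \<notin> uminus ` {u \<in> pos D. u \<bullet> ?p = 0}" if "u \<in> pos D" for u
      using that uminus_pos_iff[OF D] pos_subset by blast
    then show ?thesis
      unfolding sep_eq_diff[OF W(1)] W(2) using p_nonneg by force
  qed
  show thesis
  proof (rule that[OF W(1)])
    show "\<alpha> \<in> sep D W" "\<beta> \<in> sep D W" using \<alpha>\<beta> \<alpha>\<beta>p sepW by blast+
    fix u assume "u \<in> sep D W"
    then have u: "u \<in> pos D" "(\<Sum>b'\<in>B - {a, b}. u \<bullet> b') = 0" using sepW p by auto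
    have u0: "u \<bullet> b' = 0" if "b' \<in> B - {a, b}" for b'
      using u nonneg fin that sum_nonneg_eq_0_iff[of "B - {a, b}" "\<lambda>b'. u \<bullet> b'"] by blast
    \<comment> \<open>The coefficients are read off at \<open>a\<close> and \<open>b\<close>, where
      only one of \<alpha> and \<beta> is nonzero; agreement on the whole basis then gives
      equality.\<close>
    define c where "c = (u \<bullet> a) / (\<alpha> \<bullet> a)"
    define d where "d = (u \<bullet> b) / (\<beta> \<bullet> b)"
    have "(u - (c *\<^sub>R \<alpha> + d *\<^sub>R \<beta>)) \<bullet> b' = 0" if "b' \<in> B" for b'
    proof -
      consider "b' = a" | "b' = b" | "b' \<in> B - {a, b}" using \<open>b' \<in> B\<close> by blast
      then show ?thesis
      proof cases
        case 1
        have "\<beta> \<bullet> a = 0" using a(1) b(3) \<open>a \<noteq> b\<close> by blast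
        then show ?thesis using 1 a(2) by (simp add: c_def inner_diff_left inner_add_left)
      next
        case 2
        have "\<alpha> \<bullet> b = 0" using b(1) a(3) \<open>a \<noteq> b\<close> by blast
        then show ?thesis using 2 b(2) by (simp add: d_def inner_diff_left inner_add_left)
      next
        case 3
        then have "\<alpha> \<bullet> b' = 0" "\<beta> \<bullet> b' = 0" using a(3) b(3) by blast+
        then show ?thesis using u0[OF 3] by (simp add: inner_diff_left inner_add_left)
      qed
    qed
    then have "u - (c *\<^sub>R \<alpha> + d *\<^sub>R \<beta>) = 0" by (rule orthogonal_to_spanning_set[OF B(2)])
    moreover have "0 \<le> c" "0 \<le> d"
      using nonneg[OF u(1) a(1)] nonneg[OF u(1) b(1)] a(2) b(2) by (simp_all add: c_def d_def)
    ultimately show "\<exists>c d. 0 \<le> c \<and> 0 \<le> d \<and> u = c *\<^sub>R \<alpha> + d *\<^sub>R \<beta>" by auto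
  qed
qed

section \<open>Covers and rank two joins in the order by separation sets\<close>

lemma sep_inject:
  assumes "D \<in> chambers \<H>" "M \<in> chambers \<H>" "E \<in> chambers \<H>" "sep E D = sep E M"
  shows "D = M"
proof (rule chamber_eqI_subset[OF assms(1,2)])
  show "pos D \<subseteq> pos M"
  proof
    fix u assume u: "u \<in> pos D"
    show "u \<in> pos M"
    proof (cases "u \<in> pos E")
      case True
      then show ?thesis using u assms(4) sep_eq_diff[OF assms(1), of E] sep_eq_diff[OF assms(2), of E] by blast
    next
      case False
      then have "- u \<in> sep E D"
        using u pos_subset uminus_pos_iff[OF assms(3)] by (auto simp: sep_def)
      then have "- u \<in> sep E M" using assms(4) by blast
      then show ?thesis by (simp add: sep_def)
    qed
  qed
qed

text \<open>The last assumption says that the hyperplanes between \<open>D\<close> and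
  \<open>W\<close> have \<open>E\<close> and \<open>D\<close> on the same side, so going on to
  \<open>W\<close> never recrosses a hyperplane between \<open>E\<close> and
  \<open>D\<close>.\<close>

lemma sep_chain:
  assumes "E \<in> chambers \<H>" "D \<in> chambers \<H>" "W \<in> chambers \<H>" "sep D W \<subseteq> pos E"
  shows "sep E W = sep E D \<union> sep D W"
proof -
  have "u \<notin> pos W" if "u \<in> pos E" "u \<notin> pos D" for u
  proof
    assume "u \<in> pos W"
    then have "- u \<in> sep D W"
      using that uminus_pos_iff[OF assms(2)] pos_subset by (auto simp: sep_def)
    then show False using assms that uminus_pos_iff[OF assms(1)] pos_subset by blast
  qed
  then show ?thesis using assms(4) by (auto simp: sep_eq_diff assms)
qed

text \<open>Were \<alpha> negative at \<open>E\<close>, its hyperplane would separate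
  \<open>E\<close> from \<open>D\<close>, hence also from \<open>M\<close>, giving \<alpha> the
  wrong sign at \<open>M\<close>.\<close>

lemma sep_above:
  assumes "E \<in> chambers \<H>" "D \<in> chambers \<H>" "M \<in> chambers \<H>" "sep E D \<subseteq> sep E M"
    "\<alpha> \<in> sep D M"
  shows "\<alpha> \<in> sep E M - sep E D"
proof -
  have \<alpha>: "\<alpha> \<in> pos D" "- \<alpha> \<in> pos M" "\<alpha> \<in> U" using assms(5) pos_subset by (auto simp: sep_def)
  have "\<alpha> \<in> pos E"
  proof (rule ccontr)
    assume "\<alpha> \<notin> pos E"
    then have "- \<alpha> \<in> sep E D" using \<alpha> uminus_pos_iff[OF assms(1)] by (simp add: sep_def)
    then have "\<alpha> \<in> pos M" using assms(4) by (auto simp: sep_def)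
    then show False using \<alpha> uminus_pos_iff[OF assms(3)] by blast
  qed
  then show ?thesis using \<alpha> by (auto simp: sep_eq_diff[OF assms(2)] sep_def[of E M])
qed

text \<open>Crossing a wall of \<open>z\<close> towards \<open>M\<close> moves away from
  \<open>E\<close>, so it yields a cover of \<open>z\<close> inside the interval up to
  \<open>M\<close>.\<close>

lemma cover_below:
  assumes E: "E \<in> chambers \<H>" and z: "z \<in> chambers \<H>" and M: "M \<in> chambers \<H>"
    and le: "sep E z \<subseteq> sep E M" and "z \<noteq> M"
  obtains \<alpha> a where "\<alpha> \<in> simple_roots z" "\<alpha> \<in> pos E" "\<alpha> \<notin> sep E z" "a \<in> chambers \<H>"
    "sep E a = insert \<alpha> (sep E z)" "sep E a \<subseteq> sep E M"
proof -
  obtain \<alpha> where \<alpha>: "\<alpha> \<in> simple_roots z" "\<alpha> \<in> sep z M"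
    using simple_root_separating[OF z M \<open>z \<noteq> M\<close>] by blast
  have above: "\<alpha> \<in> sep E M - sep E z" by (rule sep_above[OF E z M le \<alpha>(2)])
  then have "\<alpha> \<in> pos E" by (simp add: sep_def)
  obtain a where a: "a \<in> chambers \<H>" "pos a = insert (- \<alpha>) (pos z - {\<alpha>})" "sep z a = {\<alpha>}"
    by (rule flip[OF z \<alpha>(1)])
  then have "sep E a = insert \<alpha> (sep E z)"
    using sep_chain[OF E z a(1)] \<open>\<alpha> \<in> pos E\<close> by simp
  then show thesis using that \<alpha>(1) a(1) above \<open>\<alpha> \<in> pos E\<close> le by auto
qed

text \<open>The roots separating \<open>z\<close> from \<open>W\<close> are nonnegative combinations
  of \<alpha> and \<beta>. They are therefore positive at \<open>E\<close>, which puts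
  \<open>W\<close> above \<open>z\<close>, and negative beyond both walls, which puts
  \<open>W\<close> below every common upper bound.\<close>

lemma rank_two_join:
  assumes E: "E \<in> chambers \<H>" and z: "z \<in> chambers \<H>" and "open_simplicial_cone z"
    and \<alpha>: "\<alpha> \<in> simple_roots z" "\<alpha> \<in> pos E" and \<beta>: "\<beta> \<in> simple_roots z" "\<beta> \<in> pos E"
    and "\<alpha> \<noteq> \<beta>"
  obtains W where "W \<in> chambers \<H>" "insert \<alpha> (insert \<beta> (sep E z)) \<subseteq> sep E W"
    "\<And>M. M \<in> chambers \<H> \<Longrightarrow> insert \<alpha> (insert \<beta> (sep E z)) \<subseteq> sep E M \<Longrightarrow> sep E W \<subseteq> sep E M"
proof -
  obtain W where W: "W \<in> chambers \<H>" "\<alpha> \<in> sep z W" "\<beta> \<in> sep z W"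
    "\<And>u. u \<in> sep z W \<Longrightarrow> \<exists>c d. 0 \<le> c \<and> 0 \<le> d \<and> u = c *\<^sub>R \<alpha> + d *\<^sub>R \<beta>"
    by (rule opposite_across_codim_two_face[OF z assms(3) \<alpha>(1) \<beta>(1) \<open>\<alpha> \<noteq> \<beta>\<close>]) blast
  have sepU: "u \<in> U" if "u \<in> sep z W" for u using that pos_subset by (auto simp: sep_def)
  have W_pos: "sep z W \<subseteq> pos E"
  proof
    fix u assume u: "u \<in> sep z W"
    obtain e where e: "e \<in> E" using E chamber_nonempty by blast
    obtain c d where "0 \<le> c" "0 \<le> d" "u = c *\<^sub>R \<alpha> + d *\<^sub>R \<beta>" using W(4)[OF u] by blast
    moreover have "0 < \<alpha> \<bullet> e" "0 < \<beta> \<bullet> e" using \<alpha>(2) \<beta>(2) e by (auto simp: pos_def)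
    ultimately have "0 \<le> u \<bullet> e" by (simp add: inner_add_left)
    then have "\<not> 0 < - u \<bullet> e" by simp
    then have "- u \<notin> pos E" using e unfolding pos_def by blast
    then show "u \<in> pos E" using uminus_pos_iff[OF E] sepU[OF u] by blast
  qed
  have sepW: "sep E W = sep E z \<union> sep z W" by (rule sep_chain[OF E z W(1) W_pos])
  show thesis
  proof (rule that[OF W(1)])
    show "insert \<alpha> (insert \<beta> (sep E z)) \<subseteq> sep E W" using sepW W by blast
    fix M assume M: "M \<in> chambers \<H>" "insert \<alpha> (insert \<beta> (sep E z)) \<subseteq> sep E M"
    obtain m where m: "m \<in> M" using M chamber_nonempty by blast
    have "0 < - \<alpha> \<bullet> m" "0 < - \<beta> \<bullet> m" using M(2) m by (auto simp: sep_def pos_def)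
    then have neg: "\<alpha> \<bullet> m < 0" "\<beta> \<bullet> m < 0" by simp_all
    have "u \<in> sep E M" if u: "u \<in> sep z W" for u
    proof -
      obtain c d where "0 \<le> c" "0 \<le> d" "u = c *\<^sub>R \<alpha> + d *\<^sub>R \<beta>" using W(4)[OF u] by blast
      \<comment> \<open>The weak inequality suffices, since roots in \<open>pos M\<close> are
        strictly positive at \<open>m\<close>.\<close>
      then have "u \<bullet> m \<le> 0"
        using neg by (simp add: inner_add_left add_nonpos_nonpos mult_nonneg_nonpos)
      then have "u \<notin> pos M" using m pos_inner[of u M m] by auto
      then show ?thesis using W_pos u by (auto simp: sep_eq_diff[OF M(1)])
    qed
    then show "sep E W \<subseteq> sep E M" using M(2) sepW by blast
  qed
qed

lemma card_sep_le: "card (sep E D) \<le> card U"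
  by (rule card_mono[OF finite_unit_normals]) (use pos_subset in \<open>auto simp: sep_def\<close>)

lemma highest_chamber:
  assumes "Q D"
  obtains M where "Q M" "\<And>M'. Q M' \<Longrightarrow> card (sep E M') \<le> card (sep E M)"
  using ex_has_greatest_nat[of Q D "\<lambda>M. card (sep E M)" "Suc (card U)"] assms card_sep_le
    le_imp_less_Suc by blast

text \<open>If the lower bounds of \<open>X\<close> had two maximal elements, take a lower bound \<open>z\<close> of highest rank
  below two of them, \<open>N1\<close> and \<open>N2\<close>. The join of a cover of \<open>z\<close> below \<open>N1\<close> and one below \<open>N2\<close> is
  again a lower bound of \<open>X\<close>, and a maximal lower bound above that join shares with \<open>N1\<close> or with
  \<open>N2\<close> an element of higher rank than \<open>z\<close>.\<close>

lemma simplicial_meet: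
  assumes simplicial: "simplicial_arrangement \<H>" and E: "E \<in> chambers \<H>"
    and X: "X \<subseteq> chambers \<H>"
  obtains M where "M \<in> chambers \<H>" "\<And>x. x \<in> X \<Longrightarrow> sep E M \<subseteq> sep E x"
    "\<And>D. D \<in> chambers \<H> \<Longrightarrow> (\<And>x. x \<in> X \<Longrightarrow> sep E D \<subseteq> sep E x) \<Longrightarrow> sep E D \<subseteq> sep E M"
proof -
  define L where "L = {D \<in> chambers \<H>. \<forall>x\<in>X. sep E D \<subseteq> sep E x}"
  define maximal where "maximal M \<longleftrightarrow> M \<in> L \<and> (\<forall>D\<in>L. sep E M \<subseteq> sep E D \<longrightarrow> D = M)" for M
  have L: "D \<in> chambers \<H>" if "D \<in> L" for D using that by (simp add: L_def)
  have "E \<in> L" using E by (simp add: L_def sep_self)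
  have above: "\<exists>M. maximal M \<and> sep E D \<subseteq> sep E M" if DL: "D \<in> L" for D
  proof -
    let ?Q = "\<lambda>M. M \<in> L \<and> sep E D \<subseteq> sep E M"
    obtain M where M: "?Q M" "\<And>M'. ?Q M' \<Longrightarrow> card (sep E M') \<le> card (sep E M)"
      using highest_chamber[of ?Q D E] DL by blast
    have "D' = M" if "D' \<in> L" "sep E M \<subseteq> sep E D'" for D'
    proof -
      have "sep E M = sep E D'"
        using M(2)[of D'] that M(1) card_seteq[OF finite_sep that(2)] by blast
      then show ?thesis using sep_inject L that(1) M(1) E by metis
    qed
    then show ?thesis using M(1) unfolding maximal_def by blast
  qed
  have unique: "M1 = M2" if M12: "maximal M1" "maximal M2" for M1 M2
  proof (rule ccontr)
    assume "M1 \<noteq> M2"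
    let ?Z = "\<lambda>z. z \<in> L \<and> (\<exists>M1 M2. maximal M1 \<and> maximal M2 \<and> M1 \<noteq> M2 \<and>
      sep E z \<subseteq> sep E M1 \<and> sep E z \<subseteq> sep E M2)"
    have "?Z E" using \<open>E \<in> L\<close> M12 \<open>M1 \<noteq> M2\<close> by (auto simp: sep_self[OF E])
    then obtain z where z: "?Z z" "\<And>z'. ?Z z' \<Longrightarrow> card (sep E z') \<le> card (sep E z)"
      using highest_chamber[of ?Z E E] by blast
    have zL: "z \<in> L" "z \<in> chambers \<H>" using z(1) L by blast+
    \<comment> \<open>By the choice of \<open>z\<close>, a lower bound of rank one higher and above
      \<open>z\<close> cannot lie below two distinct maximal ones.\<close>
    have no_higher: "M = M'"
      if "maximal M" "maximal M'" "a \<in> L" "sep E a = insert \<alpha> (sep E z)" "\<alpha> \<notin> sep E z"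
        "sep E a \<subseteq> sep E M" "sep E a \<subseteq> sep E M'" for M M' a \<alpha>
    proof (rule ccontr)
      assume "M \<noteq> M'"
      then have "card (sep E a) \<le> card (sep E z)" using z(2)[of a] that by blast
      then show False using that(4,5) finite_sep by simp
    qed
    obtain N1 N2 where N: "maximal N1" "maximal N2" "N1 \<noteq> N2"
      "sep E z \<subseteq> sep E N1" "sep E z \<subseteq> sep E N2" using z(1) by blast
    have NL: "N1 \<in> L" "N2 \<in> L" using N unfolding maximal_def by blast+
    have "z \<noteq> N1" "z \<noteq> N2" using N NL unfolding maximal_def by blast+
    have down: "D \<in> L" if "D \<in> chambers \<H>" "sep E D \<subseteq> sep E N" "N \<in> L" for D N
      using that by (auto simp: L_def)
    obtain \<alpha> a where a: "\<alpha> \<in> simple_roots z" "\<alpha> \<in> pos E" "\<alpha> \<notin> sep E z" "a \<in> chambers \<H>"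
      "sep E a = insert \<alpha> (sep E z)" "sep E a \<subseteq> sep E N1"
      by (rule cover_below[OF E zL(2) L[OF NL(1)] N(4) \<open>z \<noteq> N1\<close>])
    obtain \<beta> b where b: "\<beta> \<in> simple_roots z" "\<beta> \<in> pos E" "\<beta> \<notin> sep E z" "b \<in> chambers \<H>"
      "sep E b = insert \<beta> (sep E z)" "sep E b \<subseteq> sep E N2"
      by (rule cover_below[OF E zL(2) L[OF NL(2)] N(5) \<open>z \<noteq> N2\<close>])
    have aL: "a \<in> L" and bL: "b \<in> L" using down a(4,6) b(4,6) NL by blast+
    have "\<alpha> \<noteq> \<beta>"
    proof
      assume "\<alpha> = \<beta>"
      then have "sep E a \<subseteq> sep E N2" using a(5) b(5,6) by simp
      then show False using no_higher[OF N(1,2) aL a(5,3,6)] N(3) by blast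
    qed
    have z_cone: "open_simplicial_cone z"
      using simplicial zL(2) by (simp add: simplicial_arrangement_def)
    obtain W where W: "W \<in> chambers \<H>" "insert \<alpha> (insert \<beta> (sep E z)) \<subseteq> sep E W"
      "\<And>M. M \<in> chambers \<H> \<Longrightarrow> insert \<alpha> (insert \<beta> (sep E z)) \<subseteq> sep E M \<Longrightarrow> sep E W \<subseteq> sep E M"
      by (rule rank_two_join[OF E zL(2) z_cone a(1,2) b(1,2) \<open>\<alpha> \<noteq> \<beta>\<close>]) blast
    \<comment> \<open>Both \<open>a\<close> and \<open>b\<close> are lower bounds, so every
      \<open>x\<close> lies beyond both walls and above their join.\<close>
    have "sep E W \<subseteq> sep E x" if "x \<in> X" for x
    proof (rule W(3))
      show "x \<in> chambers \<H>" using X that by blast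
      show "insert \<alpha> (insert \<beta> (sep E z)) \<subseteq> sep E x"
        using aL bL that a(5) b(5) by (auto simp: L_def)
    qed
    then have "W \<in> L" using W(1) by (simp add: L_def)
    then obtain M where M: "maximal M" "sep E W \<subseteq> sep E M" using above by blast
    have "sep E a \<subseteq> sep E M" "sep E b \<subseteq> sep E M" using W(2) M(2) a(5) b(5) by auto
    then have "N1 = M" "N2 = M"
      using no_higher[OF N(1) M(1) aL a(5,3,6)] no_higher[OF N(2) M(1) bL b(5,3,6)] by blast+
    then show False using N(3) by simp
  qed
  obtain M where M: "maximal M" using above[OF \<open>E \<in> L\<close>] by blast
  show thesis
  proof (rule that)
    show "M \<in> chambers \<H>" "\<And>x. x \<in> X \<Longrightarrow> sep E M \<subseteq> sep E x"
      using M by (auto simp: maximal_def L_def)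
    fix D assume "D \<in> chambers \<H>" "\<And>x. x \<in> X \<Longrightarrow> sep E D \<subseteq> sep E x"
    then have "D \<in> L" by (simp add: L_def)
    then show "sep E D \<subseteq> sep E M" using above unique[OF M] by blast
  qed
qed

section \<open>The signed groupoid-set\<close>

abbreviation R :: "('a set, 'a set \<times> 'a set, 'a) signed_groupoid_set_data" where
  "R \<equiv> arrangement_sgs \<H>"

lemma arrangement_sgs_simps [simp]:
  "Obj R = chambers \<H>" "Mor R = chambers \<H> \<times> chambers \<H>" "Dom R = snd" "Cod R = fst"
  "Idt R = (\<lambda>D. (D, D))" "Comp R = (\<lambda>g f. (fst g, snd f))"
  by (simp_all add: arrangement_sgs_def)

lemma inversion_set_eq_sep: "inversion_set R g = sep (fst g) (snd g)"
proof -
  have "inversion_set R g = pos (fst g) \<inter> uminus ` pos (snd g)"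
    by (simp add: inversion_set_def arrangement_sgs_def pos_def)
  moreover have "u \<in> uminus ` pos D \<longleftrightarrow> - u \<in> pos D" for u D
    by (metis image_eqI image_iff minus_minus)
  ultimately show ?thesis by (auto simp: sep_def)
qed

lemma carrier_weak_order:
  assumes "E \<in> chambers \<H>"
  shows "carrier (weak_order R E) = sep E ` chambers \<H>"
  using assms by (force simp: weak_order_def inversion_set_eq_sep)

lemma le_weak_order [simp]: "le (weak_order R E) = (\<subseteq>)"
  by (simp add: weak_order_def)

lemma signed_groupoid_set_R: "signed_groupoid_set R"
  using central by (rule signed_groupoid_set_arrangement_sgs)

lemma partial_order_weak_order: "partial_order (weak_order R E)"
  by unfold_locales (auto simp: weak_order_def)

text \<open>Every hyperplane separates \<open>E\<close> from its opposite chamber.\<close>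

lemma top_weak_order:
  assumes "E \<in> chambers \<H>"
  shows "pos E \<in> carrier (weak_order R E)"
proof -
  obtain D where D: "D \<in> chambers \<H>" "pos D = uminus ` pos E" by (rule opposite_chamber[OF assms])
  have "sep E D = pos E" unfolding sep_def D(2) by auto
  then show ?thesis using D(1) by (auto simp: carrier_weak_order[OF assms])
qed

lemma sep_subset_pos: "sep E D \<subseteq> pos E"
  by (auto simp: sep_def)

section \<open>From rootoidal to simplicial\<close>

text \<open>The join is the meet of all upper bounds; the top element \<open>pos E\<close>
  guarantees that there is one, as the meet axiom requires a nonempty set.\<close>

lemma rootoidal_join:
  assumes "rootoidal R" and E: "E \<in> chambers \<H>" and X: "X \<subseteq> carrier (weak_order R E)"
  shows "\<exists>J. least (weak_order R E) J (Upper (weak_order R E) X)"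
proof -
  let ?L = "weak_order R E"
  have sub: "Upper ?L X \<subseteq> carrier ?L" by (auto simp: Upper_def)
  have "pos E \<in> Upper ?L X"
    using top_weak_order[OF E] sep_subset_pos by (auto simp: Upper_def carrier_weak_order[OF E])
  then obtain M where M: "greatest ?L M (Lower ?L (Upper ?L X))"
    using rootoidal.meet_exists[OF assms(1) _ sub] E by auto
  have "x \<subseteq> M" if "x \<in> X" for x
  proof -
    have "x \<in> Lower ?L (Upper ?L X)" using X that by (auto simp: Lower_def Upper_def)
    then show ?thesis using M by (auto simp: greatest_def)
  qed
  moreover have "M \<in> carrier ?L" using M by (auto simp: greatest_def Lower_def)
  ultimately have "M \<in> Upper ?L X" by (auto simp: Upper_def)
  moreover have "M \<subseteq> y" if "y \<in> Upper ?L X" for y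
  proof -
    have "y \<in> carrier ?L" using that sub by blast
    then show ?thesis using M that by (auto simp: greatest_def Lower_def)
  qed
  ultimately show ?thesis using sub by (intro exI[of _ M]) (simp add: least_def)
qed

text \<open>In a linear relation between simple roots, the join of the atoms belonging to the positive
  coefficients is disjoint from the atoms belonging to the negative ones; so a point of the chamber
  of that join makes every term of the relation nonpositive.\<close>

lemma rootoidal_imp_independent_simple_roots:
  assumes root: "rootoidal R" and E: "E \<in> chambers \<H>"
  shows "independent (simple_roots E)"
proof (rule independent_if_scalars_zero)
  let ?S = "simple_roots E" and ?L = "weak_order R E"
  show fin: "finite ?S" using simple_roots_subset finite_pos finite_subset by blast
  fix f x assume f: "(\<Sum>t\<in>?S. f t *\<^sub>R t) = 0" and x: "x \<in> ?S"
  have atom: "{t} \<in> carrier ?L" if t: "t \<in> ?S" for t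
  proof -
    obtain F where "F \<in> chambers \<H>" "pos F = insert (- t) (pos E - {t})" "sep E F = {t}"
      by (rule flip[OF E t])
    then show ?thesis by (auto simp: carrier_weak_order[OF E])
  qed
  have "\<exists>d. \<forall>t\<in>?S. (0 < f t \<longrightarrow> t \<bullet> d < 0) \<and> (f t < 0 \<longrightarrow> 0 < t \<bullet> d)"
  \<comment> \<open>The join axiom concerns nonempty families. Without positive coefficients any
    point of \<open>E\<close> itself has the required signs.\<close>
  proof (cases "\<exists>t\<in>?S. 0 < f t")
    case False
    obtain e where "e \<in> E" using E chamber_nonempty by blast
    then have "\<forall>t\<in>?S. 0 < t \<bullet> e" using simple_roots_subset pos_inner by blast
    then show ?thesis using False by blast
  next
    case True
    let ?X = "(\<lambda>t. {t}) ` {t \<in> ?S. 0 < f t}"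
    have X: "?X \<subseteq> carrier ?L" "?X \<noteq> {}" using True atom by auto
    obtain J where J: "least ?L J (Upper ?L ?X)" using rootoidal_join[OF root E X(1)] by blast
    then have "J \<in> carrier ?L" by (auto simp: least_def Upper_def)
    then obtain D where D: "D \<in> chambers \<H>" "J = sep E D" by (auto simp: carrier_weak_order[OF E])
    obtain d where d: "d \<in> D" using D(1) chamber_nonempty by blast
    have "t \<bullet> d < 0" if t: "t \<in> ?S" "0 < f t" for t
    proof -
      have "{t} \<in> ?X" using t by blast
      moreover have "{t} \<in> carrier ?L" using t atom by blast
      ultimately have "{t} \<subseteq> J" using J by (auto simp: least_def Upper_def)
      then have "- t \<in> pos D" by (simp add: D(2) sep_def)
      then show ?thesis using pos_inner[OF _ d, of "- t"] by simp
    qed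
    moreover have "0 < t \<bullet> d" if t: "t \<in> ?S" "f t < 0" for t
    proof -
      have "J \<inter> {t} = {}"
      proof (rule rootoidal.join_orthogonality[OF root _ X(1,2) atom[OF t(1)] _ J])
        show "A \<inter> {t} = {}" if "A \<in> ?X" for A using that t(2) by auto
      qed (use E in simp)
      then have "t \<in> pos D"
        using t(1) simple_roots_subset by (auto simp: D(2) sep_eq_diff[OF D(1)])
      then show ?thesis using pos_inner d by blast
    qed
    ultimately show ?thesis by blast
  qed
  then obtain d where d: "\<And>t. t \<in> ?S \<Longrightarrow> 0 < f t \<Longrightarrow> t \<bullet> d < 0"
    "\<And>t. t \<in> ?S \<Longrightarrow> f t < 0 \<Longrightarrow> 0 < t \<bullet> d" by blast
  \<comment> \<open>Pairing the relation with \<open>d\<close> gives a vanishing sum of terms of one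
    sign, so every term is 0; \<open>t \<bullet> d\<close> is nonzero wherever \<open>f t\<close>
    is.\<close>
  have nonneg: "0 \<le> - (f t * (t \<bullet> d))" if "t \<in> ?S" for t
    using d[OF that] by (cases "f t" "0::real" rule: linorder_cases)
      (auto simp: mult_nonneg_nonpos mult_nonpos_nonneg less_imp_le)
  have "(\<Sum>t\<in>?S. - (f t * (t \<bullet> d))) = - ((\<Sum>t\<in>?S. f t *\<^sub>R t) \<bullet> d)"
    by (simp add: inner_sum_left sum_negf)
  then have "(\<Sum>t\<in>?S. - (f t * (t \<bullet> d))) = 0" by (simp add: f)
  then have "\<forall>t\<in>?S. - (f t * (t \<bullet> d)) = 0"
    using sum_nonneg_eq_0_iff[of ?S "\<lambda>t. - (f t * (t \<bullet> d))", OF fin nonneg] by blast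
  then have "f x * (x \<bullet> d) = 0" using x by force
  then show "f x = 0" using d[OF x] by (metis less_irrefl linorder_neqE mult_eq_0_iff)
qed

text \<open>The simple roots are a basis: besides being independent, they span because their cone
  contains \<open>pos E\<close> and the arrangement is essential. \<open>E\<close> is the open cone
  on which they are all positive, so the dual basis spans it.\<close>

lemma rootoidal_imp_simplicial:
  assumes "rootoidal R"
  shows "simplicial_arrangement \<H>"
  unfolding simplicial_arrangement_def
proof
  fix E assume E: "E \<in> chambers \<H>"
  let ?S = "simple_roots E"
  have "convex_cone hull ?S \<subseteq> span ?S"
    by (rule hull_minimal) (auto intro: span_base convex_cone_span)
  then have pos: "pos E \<subseteq> span ?S" using pos_subset_cone_simple_roots[OF E] by blast
  have "u \<in> span ?S" if "u \<in> U" for u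
  proof (cases "u \<in> pos E")
    case False
    then have "- u \<in> span ?S" using pos uminus_pos_iff[OF E that] by blast
    then show ?thesis using span_neg by fastforce
  qed (use pos in blast)
  then have "span U \<subseteq> span ?S" by (simp add: span_minimal subsetI)
  then have "span ?S = UNIV" using span_unit_normals by blast
  then have "open_simplicial_cone {x. \<forall>s\<in>?S. 0 < s \<bullet> x}"
    by (rule open_simplicial_cone_dual[OF rootoidal_imp_independent_simple_roots[OF assms E]])
  moreover have "{x. \<forall>s\<in>?S. 0 < s \<bullet> x} = E"
  proof (intro equalityI subsetI)
    fix x assume "x \<in> {x. \<forall>s\<in>?S. 0 < s \<bullet> x}"
    then show "x \<in> E"
      using pos_positive_of_simple_roots[OF E] by (simp add: mem_chamber_iff[OF E])
  next
    fix x assume "x \<in> E"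
    then show "x \<in> {x. \<forall>s\<in>?S. 0 < s \<bullet> x}" using simple_roots_subset pos_inner by blast
  qed
  ultimately show "open_simplicial_cone E" by simp
qed

section \<open>From simplicial to rootoidal and complete\<close>

lemma simplicial_weak_order_meet:
  assumes "simplicial_arrangement \<H>" and E: "E \<in> chambers \<H>"
    and X: "X \<subseteq> carrier (weak_order R E)"
  shows "\<exists>M. greatest (weak_order R E) M (Lower (weak_order R E) X)"
proof -
  let ?Y = "{D \<in> chambers \<H>. sep E D \<in> X}"
  have X_eq: "X = sep E ` ?Y" using X by (auto simp: carrier_weak_order[OF E])
  obtain M where M: "M \<in> chambers \<H>" "\<And>x. x \<in> ?Y \<Longrightarrow> sep E M \<subseteq> sep E x"
    "\<And>D. D \<in> chambers \<H> \<Longrightarrow> (\<And>x. x \<in> ?Y \<Longrightarrow> sep E D \<subseteq> sep E x) \<Longrightarrow> sep E D \<subseteq> sep E M"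
    by (rule simplicial_meet[OF assms(1) E, of ?Y]) blast+
  have "sep E M \<in> Lower (weak_order R E) X"
    using M(1,2) by (auto simp: Lower_def carrier_weak_order[OF E])
  moreover have "A \<subseteq> sep E M" if A: "A \<in> Lower (weak_order R E) X" for A
  proof -
    obtain D where D: "D \<in> chambers \<H>" "A = sep E D"
      using A by (auto simp: Lower_def carrier_weak_order[OF E])
    have "sep E D \<subseteq> sep E x" if x: "x \<in> ?Y" for x
      using A D x X by (auto simp: Lower_def)
    then show ?thesis using M(3)[OF D(1)] D(2) by blast
  qed
  moreover have "Lower (weak_order R E) X \<subseteq> carrier (weak_order R E)" by (auto simp: Lower_def)
  ultimately show ?thesis by (intro exI[of _ "sep E M"]) (simp add: greatest_def)
qed

lemma simplicial_imp_rootoidal: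
  assumes "simplicial_arrangement \<H>"
  shows "rootoidal R"
proof (intro rootoidal.intro rootoidal_axioms.intro signed_groupoid_set_R)
  fix g assume g: "g \<in> Mor R" "inversion_set R g = {}"
  then obtain E D where ED: "g = (E, D)" "E \<in> chambers \<H>" "D \<in> chambers \<H>" by auto
  then have "sep E D = sep E E" using g(2) sep_self by (simp add: inversion_set_eq_sep)
  then have "D = E" using sep_inject ED by blast
  then show "g = Idt R (Cod R g)" using ED by simp
next
  fix E X assume "E \<in> Obj R" "X \<subseteq> carrier (weak_order R E)"
  then show "\<exists>M. greatest (weak_order R E) M (Lower (weak_order R E) X)"
    using simplicial_weak_order_meet[OF assms] by simp
next
  fix E X B J
  assume E: "E \<in> Obj R" and X: "X \<subseteq> carrier (weak_order R E)"
    and B: "B \<in> carrier (weak_order R E)" and disj: "\<And>A. A \<in> X \<Longrightarrow> A \<inter> B = {}"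
    and J: "least (weak_order R E) J (Upper (weak_order R E) X)"
  have EC: "E \<in> chambers \<H>" using E by simp
  obtain D where D: "D \<in> chambers \<H>" "B = sep E D" using B by (auto simp: carrier_weak_order[OF EC])
  obtain D' where D': "D' \<in> chambers \<H>" "pos D' = uminus ` pos D" by (rule opposite_chamber[OF D(1)])
  \<comment> \<open>Being disjoint from \<open>sep E D\<close> now means lying inside
    \<open>sep E D'\<close>. So \<open>D'\<close> gives an upper bound of \<open>X\<close>, and the
    join stays below it.\<close>
  have compl: "sep E D' = pos E - sep E D"
  proof -
    have "- u \<in> pos D' \<longleftrightarrow> u \<in> pos D" for u using D'(2) by auto
    then show ?thesis by (auto simp: sep_def[of E D'] sep_eq_diff[OF D(1)])
  qed
  have "A \<subseteq> sep E D'" if "A \<in> X" for A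
  proof -
    have "A \<subseteq> pos E" using that X sep_subset_pos by (auto simp: carrier_weak_order[OF EC])
    then show ?thesis using disj[OF that] compl D(2) by blast
  qed
  then have "sep E D' \<in> Upper (weak_order R E) X"
    using D'(1) by (auto simp: Upper_def carrier_weak_order[OF EC])
  then have "J \<subseteq> sep E D'" using J by (auto simp: least_def)
  then show "J \<inter> B = {}" using compl D(2) by blast
qed

lemma simplicial_imp_complete:
  assumes "simplicial_arrangement \<H>"
  shows "complete_signed_groupoid_set R"
proof (intro complete_signed_groupoid_set.intro complete_signed_groupoid_set_axioms.intro
    signed_groupoid_set_R)
  fix E assume "E \<in> Obj R"
  then have E: "E \<in> chambers \<H>" by simp
  show "Complete_Lattice.complete_lattice (weak_order R E)"
  proof (rule partial_order.complete_lattice_criterion1[OF partial_order_weak_order])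
    have "greatest (weak_order R E) (pos E) (carrier (weak_order R E))"
      using top_weak_order[OF E] sep_subset_pos
      by (auto simp: greatest_def carrier_weak_order[OF E])
    then show "\<exists>g. greatest (weak_order R E) g (carrier (weak_order R E))" ..
  qed (rule simplicial_weak_order_meet[OF assms E])
qed

section \<open>Principality: length equals the number of separating hyperplanes\<close>

lemma simple_morphism_iff:
  "g \<in> simple_morphisms R \<longleftrightarrow> g \<in> chambers \<H> \<times> chambers \<H> \<and> card (sep (fst g) (snd g)) = 1"
  by (simp add: simple_morphisms_def inversion_set_eq_sep)

text \<open>A minimal gallery: crossing a wall of \<open>E\<close> that separates it from
  \<open>D\<close> removes exactly one hyperplane from the separation set.\<close>

lemma is_product_of_card_sep:
  assumes "E \<in> chambers \<H>" "D \<in> chambers \<H>"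
  shows "is_product R (simple_morphisms R) (card (sep E D)) (E, D)"
  using assms
proof (induction "card (sep E D)" arbitrary: E)
  case 0
  then have "sep E D = sep E E" using finite_sep sep_self by simp
  then have "E = D" using sep_inject 0 by metis
  then show ?case using is_product.identity[of D R] 0 by simp
next
  case (Suc n)
  have "E \<noteq> D" using Suc.hyps(2) sep_self[OF \<open>D \<in> chambers \<H>\<close>] by auto
  obtain \<alpha> where \<alpha>: "\<alpha> \<in> simple_roots E" "\<alpha> \<in> sep E D"
    by (rule simple_root_separating[OF Suc.prems \<open>E \<noteq> D\<close>])
  obtain F where F: "F \<in> chambers \<H>" "pos F = insert (- \<alpha>) (pos E - {\<alpha>})" "sep E F = {\<alpha>}"
    by (rule flip[OF Suc.prems(1) \<alpha>(1)])
  have n: "n = card (sep F D)"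
    using Suc.hyps(2) sep_flip[OF Suc.prems(2) \<alpha>(2) F(2)] \<alpha>(2) finite_sep by simp
  then have "is_product R (simple_morphisms R) n (F, D)"
    using Suc.hyps(1)[OF n] F(1) Suc.prems(2) by simp
  then have "is_product R (simple_morphisms R) (Suc n) (Comp R (E, F) (F, D))"
    by (rule is_product.factor) (use F Suc.prems in \<open>auto simp: simple_morphism_iff\<close>)
  then show ?case using Suc.hyps(2) by simp
qed

text \<open>The triangle inequality for separation sets. Each factor crosses one hyperplane, also
  when it is the inverse of a simple morphism, since the cardinality is symmetric. Membership in
  \<open>Mor R\<close> is carried along for the induction.\<close>

lemma card_sep_le_of_is_product:
  assumes "is_product R (simple_morphisms R) n g"
  shows "g \<in> Mor R \<and> card (sep (fst g) (snd g)) \<le> n"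
  using assms
proof induction
  case (identity a)
  then show ?case by (simp add: sep_self)
next
  case (factor n g t)
  obtain a b where t: "t = (a, b)" "a \<in> chambers \<H>" "b \<in> chambers \<H>" using factor.hyps by auto
  obtain c where g: "g = (b, c)" "c \<in> chambers \<H>" using factor.hyps factor.IH t by (cases g) auto
  have "card (sep a b) = 1"
    using factor.hyps(3)
  proof
    assume "t \<in> simple_morphisms R"
    then show ?thesis by (simp add: simple_morphism_iff t)
  next
    assume "\<exists>s\<in>simple_morphisms R. inverse_morphisms R s t"
    then obtain s where "s \<in> simple_morphisms R" "inverse_morphisms R s t" by blast
    then have "card (sep b a) = 1"
      by (cases s) (auto simp: simple_morphism_iff inverse_morphisms_def t)
    then show ?thesis by (simp add: card_sep_swap[of a b])
  qed
  moreover have "sep a c \<subseteq> sep a b \<union> sep b c"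
    using pos_or_neg[OF t(3)] pos_subset by (auto simp: sep_def)
  then have "card (sep a c) \<le> card (sep a b) + card (sep b c)"
    by (meson card_Un_le card_mono finite_Un finite_sep le_trans)
  ultimately show ?case using factor.IH t g by simp
qed

lemma principal_arrangement: "principal_signed_groupoid_set R"
proof (intro principal_signed_groupoid_set.intro principal_signed_groupoid_set_axioms.intro
    signed_groupoid_set_R)
  fix g assume g: "g \<in> Mor R"
  show "finite (inversion_set R g)" by (simp add: inversion_set_eq_sep finite_sep)
  have path: "is_product R (simple_morphisms R) (card (sep (fst g) (snd g))) g"
    using g is_product_of_card_sep[of "fst g" "snd g"] by auto
  then show "\<exists>n. is_product R (simple_morphisms R) n g" ..
  show "(LEAST n. is_product R (simple_morphisms R) n g) = card (inversion_set R g)"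
    unfolding inversion_set_eq_sep
    using path card_sep_le_of_is_product by (intro Least_equality) blast+
qed

section \<open>Simple morphisms and adjacency\<close>

text \<open>Components are disjoint and chambers nonempty, so the component around each chamber must
  be the half-space given by its sign.\<close>

lemma separates_iff:
  assumes "D \<in> chambers \<H>" "E \<in> chambers \<H>" and u: "u \<in> pos E"
  shows "separates {x. u \<bullet> x = 0} D E \<longleftrightarrow> u \<in> sep E D"
proof -
  let ?C = "components (UNIV - {x. u \<bullet> x = 0})"
  have "u \<noteq> 0" using u pos_nonzero by blast
  then have P: "{x. 0 < u \<bullet> x} \<in> ?C" and N: "{x. 0 < - u \<bullet> x} \<in> ?C"
    using halfspace_component[of u] halfspace_component[of "- u"] by simp_all
  have EP: "E \<subseteq> {x. 0 < u \<bullet> x}" using u by (auto simp: pos_def)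
  show ?thesis
  proof
    assume "separates {x. u \<bullet> x = 0} D E"
    then obtain A B where AB: "A \<in> ?C" "B \<in> ?C" "A \<noteq> B" "D \<subseteq> A" "E \<subseteq> B"
      unfolding separates_def by blast
    show "u \<in> sep E D"
    proof (rule ccontr)
      assume "u \<notin> sep E D"
      then have "D \<subseteq> {x. 0 < u \<bullet> x}"
        using u by (auto simp: sep_eq_diff[OF assms(1)] pos_def)
      then have "A = {x. 0 < u \<bullet> x}"
        using components_eq[OF AB(1) P] AB(4) chamber_nonempty[OF assms(1)] by blast
      moreover have "B = {x. 0 < u \<bullet> x}"
        using components_eq[OF AB(2) P] AB(5) EP chamber_nonempty[OF assms(2)] by blast
      ultimately show False using AB(3) by blast
    qed
  next
    assume "u \<in> sep E D"
    then have "D \<subseteq> {x. 0 < - u \<bullet> x}" unfolding sep_def pos_def by blast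
    moreover have "{x. 0 < - u \<bullet> x} \<noteq> {x. 0 < u \<bullet> x}"
      using EP chamber_nonempty[OF assms(2)] by force
    ultimately show "separates {x. u \<bullet> x = 0} D E"
      unfolding separates_def using EP by (intro bexI[OF _ N] bexI[OF _ P] conjI)
  qed
qed

text \<open>Sending a unit normal to its hyperplane is a bijection from \<open>sep E D\<close> onto
  the separating hyperplanes: of the two unit normals of a hyperplane exactly one is positive on
  \<open>E\<close>.\<close>

lemma adjacent_iff_card_sep:
  assumes D: "D \<in> chambers \<H>" and E: "E \<in> chambers \<H>"
  shows "adjacent \<H> D E \<longleftrightarrow> card (sep E D) = 1"
proof -
  let ?h = "\<lambda>u. {x. u \<bullet> x = 0}"
  let ?S = "{h \<in> \<H>. separates h D E}"
  have inj: "inj_on ?h (sep E D)"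
  proof (rule inj_onI)
    fix u v assume uv: "u \<in> sep E D" "v \<in> sep E D" "?h u = ?h v"
    have pos: "u \<in> pos E" "v \<in> pos E" using uv sep_subset_pos by blast+
    then have U: "u \<in> U" "v \<in> U" using pos_subset by blast+
    then have "v = u \<or> v = - u"
      using unit_normals_of_same_hyperplane[of u v] norm_unit_normal uv(3) by blast
    then show "u = v" using pos uminus_pos_iff[OF E U(1)] by blast
  qed
  have image: "?h ` sep E D = ?S"
  proof (intro equalityI subsetI)
    fix h assume "h \<in> ?h ` sep E D"
    then show "h \<in> ?S"
      using separates_iff[OF D E] hyperplane_of_unit_normal sep_subset_pos pos_subset by blast
  next
    fix h assume h: "h \<in> ?S"
    then obtain v where v: "v \<in> U" "h = ?h v" using unit_normal_of_hyperplane by blast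
    obtain u where u: "u \<in> pos E" "h = ?h u"
    proof (cases "v \<in> pos E")
      case True
      then show thesis using that v(2) by blast
    next
      case False
      then have "- v \<in> pos E" using uminus_pos_iff[OF E v(1)] by blast
      then show thesis using that[of "- v"] v(2) by simp
    qed
    then show "h \<in> ?h ` sep E D" using separates_iff[OF D E] h by blast
  qed
  have "card (sep E D) = card ?S" using card_image[OF inj] image by simp
  also have "card ?S = 1 \<longleftrightarrow> (\<exists>!h. h \<in> \<H> \<and> separates h D E)"
    by (rule card_Collect_eq_1_iff)
  finally show ?thesis using D E by (simp add: adjacent_def)
qed

lemma simple_morphisms_adjacent: "simple_morphisms R = {(E, D). adjacent \<H> D E}"
proof -
  have "(E, D) \<in> simple_morphisms R \<longleftrightarrow> adjacent \<H> D E" for E D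
    using adjacent_iff_card_sep[of D E] by (auto simp: simple_morphism_iff adjacent_def)
  then show ?thesis by auto
qed

end

theorem theorem6p11:
  fixes \<H> :: "'a::euclidean_space set set"
  assumes "hyperplane_arrangement \<H>"
    and "finite \<H>"
    and "central \<H>"
    and "essential \<H>"
  shows "(rootoidal (arrangement_sgs \<H>) \<longleftrightarrow> simplicial_arrangement \<H>) \<and>
    (rootoidal (arrangement_sgs \<H>) \<longrightarrow>
       complete_signed_groupoid_set (arrangement_sgs \<H>) \<and>
       principal_signed_groupoid_set (arrangement_sgs \<H>) \<and>
       simple_morphisms (arrangement_sgs \<H>) = {(E, D). adjacent \<H> D E})"
proof -
  interpret central_arrangement \<H> using assms by unfold_locales
  show ?thesis
    using rootoidal_imp_simplicial simplicial_imp_rootoidal simplicial_imp_complete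
      principal_arrangement simple_morphisms_adjacent by blast
qed

end
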